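(* Let $F$ be a random variable in $\mathbb{R}^N$ with law $\mu_F$ such that $\mu_F\succeq\mathrm{Leb}_N$, $\mathbb{E}(F)=0$ and $\mathbb{E}(|F|^2)<\infty$. Let $F_k$, $k\ge1$, be independent copies of $F$, let $C(F)$ be the covariance matrix of $F$, let $A(F)$ be the inverse of $C(F)^{1/2}$, and let $\mu_n$ denote the law of $$S_n=\frac1{\sqrt n}\sum_{k=1}^n A(F)F_k .$$ Let $\Gamma$ be the standard Gaussian law on $\mathbb{R}^N$. Then $$\lim_{n\to\infty} d_{TV}(\mu_n,\Gamma)=0 .$$
   Context: $\mu_F\succeq\mathrm{Leb}_N$ means: there exist $\varepsilon_0>0$ and a non-empty open set $D_0\subset\mathbb{R}^N$ such that $\mu_F(A)\ge\varepsilon_0\,\mathrm{Leb}_N(A\cap D_0)$ for every Borel set $A$, where $\mathrm{Leb}_N$ is the Lebesgue measure. Under this assumption and square integrability, $C(F)$ is invertible. The total variation distance is $d_{TV}(\mu,\nu)=\sup\{|\int f\,d\mu-\int f\,d\nu| : f \text{ measurable},\ \|f\|_\infty\le1\}$. *)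

theory Defs
  imports "HOL-Probability.Probability"
begin

definition dominates_lebesgue :: "(real ^ 'n) measure \<Rightarrow> bool" where
  "dominates_lebesgue \<mu> \<longleftrightarrow>
     (\<exists>\<epsilon>0 > (0::real). \<exists>D0. open D0 \<and> D0 \<noteq> {} \<and>
        (\<forall>A \<in> sets borel. emeasure \<mu> A \<ge> ennreal \<epsilon>0 * emeasure lborel (A \<inter> D0)))"

(* The sup norm is the genuine supremum over all points, not an essential supremum.  For
   probability measures the set of values is nonempty and bounded by 2, so the real-valued
   supremum is the actual one. *)
definition dTV :: "'a::topological_space measure \<Rightarrow> 'a measure \<Rightarrow> real" where
  "dTV \<mu> \<nu> =
     (SUP f \<in> {f \<in> borel_measurable borel. \<forall>x. \<bar>f x :: real\<bar> \<le> 1}.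
        \<bar>(\<integral>x. f x \<partial>\<mu>) - (\<integral>x. f x \<partial>\<nu>)\<bar>)"

definition covariance_matrix :: "'a measure \<Rightarrow> ('a \<Rightarrow> real ^ 'n) \<Rightarrow> real ^ 'n ^ 'n" where
  "covariance_matrix M X =
     (\<chi> i j. \<integral>\<omega>. (X \<omega> $ i - (\<integral>\<omega>'. X \<omega>' $ i \<partial>M)) * (X \<omega> $ j - (\<integral>\<omega>'. X \<omega>' $ j \<partial>M)) \<partial>M)"

definition symmetric_psd :: "real ^ 'n ^ 'n \<Rightarrow> bool" where
  "symmetric_psd B \<longleftrightarrow> transpose B = B \<and> (\<forall>x. 0 \<le> x \<bullet> (B *v x))"

(* Every symmetric positive semidefinite matrix has exactly one symmetric positive
   semidefinite square root; for other arguments the value is unspecified. *)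
definition matrix_sqrt :: "real ^ 'n ^ 'n \<Rightarrow> real ^ 'n ^ 'n" where
  "matrix_sqrt C = (THE B. symmetric_psd B \<and> B ** B = C)"

definition std_gaussian :: "(real ^ 'n) measure" where
  "std_gaussian =
     density lborel (\<lambda>x. ennreal ((2 * pi) powr (- real CARD('n) / 2) * exp (- (norm x)\<^sup>2 / 2)))"

definition independent_copies ::
  "'a measure \<Rightarrow> (nat \<Rightarrow> 'a \<Rightarrow> real ^ 'n) \<Rightarrow> 'b measure \<Rightarrow> ('b \<Rightarrow> real ^ 'n) \<Rightarrow> bool" where
  "independent_copies M Fs M0 F \<longleftrightarrow>
     prob_space.indep_vars M (\<lambda>_. borel) Fs {1..} \<and>
     (\<forall>k\<ge>1. distr M borel (Fs k) = distr M0 borel F)"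

definition normalized_sum ::
  "real ^ 'n ^ 'n \<Rightarrow> (nat \<Rightarrow> 'a \<Rightarrow> real ^ 'n) \<Rightarrow> nat \<Rightarrow> 'a \<Rightarrow> real ^ 'n" where
  "normalized_sum A Fs n \<omega> = (1 / sqrt (real n)) *\<^sub>R (\<Sum>k = 1..n. A *v Fs k \<omega>)"

end

theory Submission
  imports Defs
begin

text \<open>
  Convergence in total variation has to control every bounded measurable test function, so the
  classical central limit theorem is not enough: some regularity of the law of \<open>S\<^sub>n\<close> is needed to
  replace a test function \<open>f\<close> by a smooth one, at a cost that does not depend on \<open>f\<close>. With a standard
  Gaussian vector \<open>Z\<close> independent of everything else, and another one \<open>G\<close>, the proof passes through
  \<open>E f(S\<^sub>n)\<close>, \<open>E f(S\<^sub>n + \<delta> Z)\<close>, \<open>E f(G + \<delta> Z)\<close> and \<open>E f(G)\<close>, where \<open>\<delta>\<close> is small but fixed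
  while \<open>n\<close> grows (\<open>dTV_std_gaussian_tendsto_0\<close>).

  The first comparison is the only one that uses the domination of Lebesgue measure. For every
  sufficiently short vector \<open>s\<close>, the law of \<open>F\<close> contains a fixed proportion \<open>p\<close> of a
  measure of the form \<open>(\<nu> + \<nu> shifted by s) / 2\<close>. Hence \<open>F\<^sub>1 + \<dots> + F\<^sub>n\<close> contains about \<open>p n\<close> independent
  fair coin tosses, each of which moves the sum by \<open>0\<close> or \<open>s\<close>, and the law of the number of heads
  among \<open>m\<close> tosses changes only by \<open>O(1 / \<surd>m)\<close> in total variation when it is shifted by one. So a
  translation of the sum by \<open>s\<close> costs \<open>O(1 / \<surd>n)\<close>. A translation of \<open>S\<^sub>n\<close> by \<open>h\<close> translates the sum
  by a vector of length \<open>O(\<surd>n |h|)\<close>, which decomposes into \<open>O(\<surd>n |h| + 1)\<close> short ones, and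
  therefore costs \<open>O(|h| + 1 / \<surd>n)\<close> (\<open>expectation_translation_le\<close>). Averaging over \<open>h = \<delta> Z\<close> bounds
  the first comparison (\<open>smoothing_error_le\<close>).

  For the second one, the density of \<open>S\<^sub>n + \<delta> Z\<close> at a point is a Gaussian integral of the characteristic
  function of \<open>S\<^sub>n\<close>, since the Gaussian density is itself a Fourier transform. The covariance
  matrix of \<open>F\<close> is positive definite, because a law that dominates Lebesgue measure on an open set is
  not carried by a hyperplane, so its square root is invertible and the projection of \<open>A F\<close> on \<open>u\<close> has
  variance \<open>|u|\<^sup>2\<close>. The one-dimensional central limit theorem, applied to the projections of \<open>S\<^sub>n\<close>, gives pointwise convergence of the
  characteristic functions, hence of these densities, and by Scheffe's lemma pointwise convergence
  of probability densities is convergence in total variation (\<open>smoothed_tv_tendsto\<close>).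
  The third one follows from Scheffe's lemma again, as \<open>\<delta>\<close> tends to \<open>0\<close>
  (\<open>std_gaussian_smoothing_tv_tendsto\<close>).
\<close>

section \<open>Square roots of symmetric positive semidefinite matrices\<close>

text \<open>
  A maximiser \<open>v\<close> of the Rayleigh quotient on the unit sphere of the subspace is an eigenvector: the
  first variation in a direction orthogonal to \<open>v\<close> vanishes, so \<open>f v\<close> has no component
  orthogonal to \<open>v\<close>.
\<close>

lemma symmetric_eigenvector_in_invariant_subspace:
  fixes f :: "'v::euclidean_space \<Rightarrow> 'v"
  assumes lin: "linear f" and sym: "\<And>x y. x \<bullet> f y = f x \<bullet> y"
    and S: "subspace S" "S \<noteq> {0}" and inv: "f ` S \<subseteq> S"
  obtains v c where "v \<in> S" "norm v = 1" "f v = c *\<^sub>R v"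
proof -
  let ?K = "S \<inter> sphere 0 1"
  have "0 \<in> S" using S(1) by (rule subspace_0)
  then obtain w where w: "w \<in> S" "w \<noteq> 0" using S(2) by auto
  then have "inverse (norm w) *\<^sub>R w \<in> ?K"
    using subspace_scale[OF S(1) w(1)] by auto
  moreover have "compact ?K"
    by (intro closed_Int_compact closed_subspace S compact_sphere)
  moreover have "continuous_on ?K (\<lambda>x. x \<bullet> f x)"
    by (intro continuous_intros linear_continuous_on[of f] lin[unfolded linear_conv_bounded_linear])
  ultimately obtain v where v: "v \<in> ?K" and max: "\<And>y. y \<in> ?K \<Longrightarrow> y \<bullet> f y \<le> v \<bullet> f v"
    using continuous_attains_sup[of ?K "\<lambda>x. x \<bullet> f x"] by blast
  define c where "c = v \<bullet> f v"
  have nv: "norm v = 1" "v \<in> S" "v \<bullet> v = 1" using v by (auto simp: norm_eq_1)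
  \<comment> \<open>the maximality of \<open>c\<close> on the sphere, extended to the whole subspace by homogeneity\<close>
  have le: "y \<bullet> f y \<le> c * (y \<bullet> y)" if "y \<in> S" for y
  proof (cases "y = 0")
    case False
    have "inverse (norm y) *\<^sub>R y \<in> ?K" using subspace_scale[OF S(1) that] False by auto
    from max[OF this] have "(y \<bullet> f y) / (norm y)\<^sup>2 \<le> c"
      using lin by (simp add: linear_scale c_def power2_eq_square divide_inverse ac_simps)
    then show ?thesis using False by (simp add: dot_square_norm field_simps)
  qed (simp add: lin linear_0)
  have orth: "w \<bullet> f v = 0" if w: "w \<in> S" "w \<bullet> v = 0" for w
  proof (rule ccontr)
    assume ne: "w \<bullet> f v \<noteq> 0"
    define a where "a = w \<bullet> f v"
    define d where "d = c * (w \<bullet> w) - w \<bullet> f w"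
    have *: "2 * t * a \<le> t\<^sup>2 * d" for t
    proof -
      have "v + t *\<^sub>R w \<in> S" using nv w S(1) by (simp add: subspace_add subspace_scale)
      from le[OF this] show ?thesis
        using lin nv w sym[of v w]
        by (simp add: linear_add linear_scale inner_add_left inner_add_right a_def d_def c_def
            power2_eq_square algebra_simps inner_commute)
    qed
    have "d \<ge> 0" using le[OF w(1)] by (simp add: d_def)
    \<comment> \<open>the inequality for this step length forces \<open>a = 0\<close>\<close>
    define t where "t = a / (d + 1)"
    have a: "a = t * (d + 1)" using \<open>d \<ge> 0\<close> by (simp add: t_def)
    have "t\<^sup>2 * (d + 2) \<le> 0" using *[of t] unfolding a by (simp add: power2_eq_square algebra_simps)
    then have "t\<^sup>2 \<le> 0" using \<open>d \<ge> 0\<close> by (simp add: mult_le_0_iff)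
    then have "a = 0" using a by simp
    then show False using ne by (simp add: a_def)
  qed
  let ?w = "f v - c *\<^sub>R v"
  have wS: "?w \<in> S" using nv inv S(1) by (intro subspace_diff subspace_scale) auto
  have wv: "?w \<bullet> v = 0" using nv by (simp add: inner_diff_left inner_diff_right c_def inner_commute)
  have "?w \<bullet> ?w = ?w \<bullet> f v - c * (?w \<bullet> v)" by (simp add: inner_diff_right)
  then have "?w = 0" using orth[OF wS wv] wv by simp
  then show ?thesis using that[of v c] nv by simp
qed

text \<open>
  The orthogonal complement of a maximal orthonormal family of eigenvectors is invariant, so if it
  were nonzero it would contain a further eigenvector.
\<close>

lemma symmetric_orthonormal_eigenbasis:
  fixes f :: "'v::euclidean_space \<Rightarrow> 'v"
  assumes lin: "linear f" and sym: "\<And>x y. x \<bullet> f y = f x \<bullet> y"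
  obtains E c where "finite E" "pairwise orthogonal E" "span E = UNIV"
    "\<And>v. v \<in> E \<Longrightarrow> norm v = 1" "\<And>v. v \<in> E \<Longrightarrow> f v = c v *\<^sub>R v"
proof -
  let ?P = "\<lambda>E. pairwise orthogonal E \<and> (\<forall>v\<in>E. norm v = 1) \<and> (\<forall>v\<in>E. \<exists>a. f v = a *\<^sub>R v)"
  have fin: "finite E \<and> card E \<le> DIM('v)" if "?P E" for E
  proof -
    have "0 \<notin> E" using that by auto
    then have "independent E" using that pairwise_orthogonal_independent by blast
    then show ?thesis using independent_bound by blast
  qed
  have "?P {}" by simp
  have "\<exists>E. ?P E \<and> (\<forall>E'. ?P E' \<longrightarrow> card E' \<le> card E)"
    by (rule ex_has_greatest_nat[where P = ?P and f = card and k = "{}" and b="Suc DIM('v)"])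
      (use fin in \<open>auto simp: less_Suc_eq_le\<close>)
  then obtain E where E: "?P E" and maxE: "\<And>E'. ?P E' \<Longrightarrow> card E' \<le> card E"
    by blast
  let ?S = "{x. \<forall>v\<in>E. orthogonal v x}"
  have sub: "subspace ?S" unfolding subspace_def
    by (auto simp: orthogonal_def inner_add_right)
  have "?S = {0}"
  proof (rule ccontr)
    assume ne: "?S \<noteq> {0}"
    have "f ` ?S \<subseteq> ?S"
    proof clarsimp
      fix x v assume x: "\<forall>v\<in>E. orthogonal v x" "v \<in> E"
      then obtain a where "f v = a *\<^sub>R v" using E by blast
      then show "orthogonal v (f x)" using x sym[of v x] by (simp add: orthogonal_def)
    qed
    from symmetric_eigenvector_in_invariant_subspace[OF lin sym sub ne this]
    obtain w a where w: "w \<in> ?S" "norm w = 1" "f w = a *\<^sub>R w" by blast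
    have "w \<notin> E"
    proof
      assume "w \<in> E"
      then have "w \<bullet> w = 0" using w(1) by (auto simp: orthogonal_def)
      then show False using w(2) by simp
    qed
    moreover have "?P (insert w E)"
      using E w by (auto simp: pairwise_insert orthogonal_commute)
    ultimately show False using maxE[of "insert w E"] fin[OF E] by simp
  qed
  have "span E = UNIV"
  proof (rule ccontr)
    assume "span E \<noteq> UNIV"
    then obtain x where x: "x \<noteq> 0" "\<And>y. y \<in> span E \<Longrightarrow> orthogonal x y"
      using orthogonal_to_subspace_exists_gen[of E UNIV] by auto
    then have "x \<in> ?S" using span_base orthogonal_commute by blast
    then show False using \<open>?S = {0}\<close> x(1) by blast
  qed
  moreover from E obtain c where "\<And>v. v \<in> E \<Longrightarrow> f v = c v *\<^sub>R v" by metis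
  ultimately show ?thesis using that[of E c] E fin[OF E] by blast
qed

lemma symmetric_psdD:
  fixes B :: "real ^ 'n ^ 'n"
  assumes "symmetric_psd B"
  shows "x \<bullet> (B *v y) = (B *v x) \<bullet> y" "0 \<le> x \<bullet> (B *v x)"
  using assms unfolding symmetric_psd_def
  by (metis dot_lmul_matrix transpose_matrix_vector, metis)

lemma symmetric_psdI:
  fixes B :: "real ^ 'n ^ 'n"
  assumes "\<And>x y. x \<bullet> (B *v y) = (B *v x) \<bullet> y" "\<And>x. 0 \<le> x \<bullet> (B *v x)"
  shows "symmetric_psd B"
proof -
  have "(transpose B *v x) \<bullet> y = (B *v x) \<bullet> y" for x y
    using assms(1)[of x y] by (simp add: dot_lmul_matrix transpose_matrix_vector)
  then have "transpose B *v x = B *v x" for x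
    using vector_eq_rdot by blast
  then have "transpose B = B" by (simp add: matrix_eq)
  then show ?thesis using assms(2) by (simp add: symmetric_psd_def)
qed

text \<open>
  In an orthonormal eigenbasis the square root acts by the square roots of the eigenvalues.
\<close>

lemma psd_sqrt_exists:
  fixes C :: "real ^ 'n ^ 'n"
  assumes C: "symmetric_psd C"
  obtains B where "symmetric_psd B" "B ** B = C"
proof -
  obtain E c where E: "finite E" "pairwise orthogonal E" "span E = UNIV"
    "\<And>v. v \<in> E \<Longrightarrow> norm v = 1" and eig: "\<And>v. v \<in> E \<Longrightarrow> C *v v = c v *\<^sub>R v"
    by (rule symmetric_orthonormal_eigenbasis[OF matrix_vector_mul_linear symmetric_psdD(1)[OF C]]) blast
  have vw: "v \<bullet> w = (if v = w then 1 else 0)" if "v \<in> E" "w \<in> E" for v w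
    using E(2) E(4)[OF that(1)] that by (auto simp: pairwise_def orthogonal_def norm_eq_1)
  have c0: "0 \<le> c v" if "v \<in> E" for v
    using symmetric_psdD(2)[OF C, of v] eig[OF that] vw[OF that that] by simp
  define g where "g x = (\<Sum>v\<in>E. (sqrt (c v) * (v \<bullet> x)) *\<^sub>R v)" for x
  have ling: "linear g"
    by (rule linearI) (simp_all add: g_def inner_add_right algebra_simps sum.distrib scaleR_sum_right)
  define B where "B = matrix g"
  have B: "B *v x = g x" for x by (simp add: B_def ling matrix_works)
  have "x \<bullet> g y = g x \<bullet> y" for x y
    by (simp add: g_def inner_sum_left inner_sum_right inner_commute[of x] mult_ac)
  moreover have "0 \<le> x \<bullet> g x" for x
    by (auto simp: g_def inner_sum_right inner_commute[of x] mult.assoc c0 intro!: sum_nonneg)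
  ultimately have "symmetric_psd B" by (intro symmetric_psdI) (simp_all add: B)
  moreover have gE: "g v = sqrt (c v) *\<^sub>R v" if "v \<in> E" for v
  proof -
    have "g v = (\<Sum>w\<in>E. if w = v then sqrt (c v) *\<^sub>R v else 0)"
      unfolding g_def by (intro sum.cong) (auto simp: vw that)
    then show ?thesis using E(1) that by simp
  qed
  have "g (g x) = C *v x" for x
  proof -
    have "x \<in> span E" using E(3) by simp
    have "linear (\<lambda>x. g (g x))"
      using linear_compose[OF ling ling] by (simp add: o_def)
    then show ?thesis
      by (rule linear_eq_on[OF _ matrix_vector_mul_linear \<open>x \<in> span E\<close>])
        (simp add: gE linear_scale[OF ling] eig c0)
  qed
  then have "B ** B = C" by (simp add: matrix_eq B matrix_vector_mul_assoc[symmetric])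
  ultimately show ?thesis using that by blast
qed

text \<open>
  Let \<open>D\<close> be the difference of two square roots. On an eigenvector \<open>v\<close> of \<open>D\<close> with eigenvalue
  \<open>c \<noteq> 0\<close>, the equality of the two squares reads \<open>c (v \<bullet> B v + v \<bullet> B' v) = 0\<close>. Both terms are
  nonnegative, so both vanish, and then so does \<open>v \<bullet> D v = c |v|\<^sup>2\<close>.
\<close>

lemma psd_sqrt_unique:
  fixes B B' :: "real ^ 'n ^ 'n"
  assumes B: "symmetric_psd B" and B': "symmetric_psd B'" and eq: "B ** B = B' ** B'"
  shows "B = B'"
proof -
  let ?D = "B - B'"
  have symD: "x \<bullet> (?D *v y) = (?D *v x) \<bullet> y" for x y
    using symmetric_psdD(1)[OF B, of x y] symmetric_psdD(1)[OF B', of x y]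
    by (simp add: matrix_vector_mult_diff_rdistrib inner_diff_left inner_diff_right)
  obtain E c where E: "span E = UNIV" "\<And>v. v \<in> E \<Longrightarrow> norm v = 1"
    and eig: "\<And>v. v \<in> E \<Longrightarrow> ?D *v v = c v *\<^sub>R v"
    by (rule symmetric_orthonormal_eigenbasis[OF matrix_vector_mul_linear symD]) blast
  have "?D *v v = 0" if "v \<in> E" for v
  proof (rule ccontr)
    assume "?D *v v \<noteq> 0"
    then have cv: "c v \<noteq> 0" using eig[OF that] by auto
    have "v \<bullet> (B *v (B *v v)) = v \<bullet> (B' *v (B' *v v))"
      using eq by (simp add: matrix_vector_mul_assoc)
    \<comment> \<open>this is \<open>B\<^sup>2 - B'\<^sup>2 = B D + D B'\<close>\<close>
    then have "v \<bullet> (B *v (?D *v v)) + (?D *v v) \<bullet> (B' *v v) = 0"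
      using symmetric_psdD(1)[OF B, of v "B' *v v"] 
      by (simp add: symD[symmetric] matrix_vector_mult_diff_rdistrib matrix_vector_mult_diff_distrib
         inner_diff_left inner_diff_right symmetric_psdD(1)[OF B, of v] symmetric_psdD(1)[OF B', of v])
    then have "c v * (v \<bullet> (B *v v) + v \<bullet> (B' *v v)) = 0"
      unfolding eig[OF that] by (simp add: matrix_vector_mult_scaleR distrib_left)
    then have "v \<bullet> (B *v v) - v \<bullet> (B' *v v) = 0"
      using cv symmetric_psdD(2)[OF B, of v] symmetric_psdD(2)[OF B', of v] by auto
    then have "v \<bullet> (?D *v v) = 0" by (simp add: matrix_vector_mult_diff_rdistrib inner_diff_right)
    then show False using eig[OF that] cv E(2)[OF that] by (simp add: norm_eq_1)
  qed
  then have "?D *v x = 0" for x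
    using linear_eq_on[of "(*v) ?D" "\<lambda>_. 0" x E] E(1) by (auto simp: module_hom_zero)
  then show ?thesis by (simp add: matrix_eq matrix_vector_mult_diff_rdistrib)
qed

lemma matrix_sqrt:
  fixes C :: "real ^ 'n ^ 'n"
  assumes "symmetric_psd C"
  shows "symmetric_psd (matrix_sqrt C)" "matrix_sqrt C ** matrix_sqrt C = C"
proof -
  have "\<exists>!B. symmetric_psd B \<and> B ** B = C"
    using psd_sqrt_exists[OF assms] psd_sqrt_unique by metis
  from theI'[OF this] show "symmetric_psd (matrix_sqrt C)" "matrix_sqrt C ** matrix_sqrt C = C"
    unfolding matrix_sqrt_def by blast+
qed

text \<open>
  The last equation says that a vector with covariance matrix \<open>C\<close> acquires the identity as covariance
  matrix when \<open>A\<close> is applied to it.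
\<close>

lemma whitening_matrix:
  fixes C :: "real ^ 'n ^ 'n"
  assumes C: "symmetric_psd C" and pos: "\<And>u. u \<bullet> (C *v u) = 0 \<Longrightarrow> u = 0"
  defines "A \<equiv> matrix_inv (matrix_sqrt C)"
  shows "matrix_sqrt C ** A = mat 1" "A ** matrix_sqrt C = mat 1"
    "\<And>u x. u \<bullet> (A *v x) = (A *v u) \<bullet> x" "\<And>u. (A *v u) \<bullet> (C *v (A *v u)) = u \<bullet> u"
proof -
  let ?B = "matrix_sqrt C"
  note B = matrix_sqrt[OF C]
  note symB = symmetric_psdD(1)[OF B(1)]
  have CB: "C *v x = ?B *v (?B *v x)" for x by (simp add: matrix_vector_mul_assoc B(2))
  have "x = 0" if "?B *v x = 0" for x
    by (rule pos) (simp add: CB that)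
  then have inv: "invertible ?B"
    by (simp add: invertible_left_inverse matrix_left_invertible_ker)
  then have "?B ** A = mat 1 \<and> A ** ?B = mat 1"
    unfolding A_def matrix_inv_def invertible_def by (rule someI_ex)
  then show 1: "?B ** A = mat 1" "A ** ?B = mat 1" by auto
  have BA: "?B *v (A *v x) = x" for x
    by (simp add: matrix_vector_mul_assoc 1)
  show "u \<bullet> (A *v x) = (A *v u) \<bullet> x" for u x
    using symB[of "A *v u" "A *v x"] by (simp add: BA)
  show "(A *v u) \<bullet> (C *v (A *v u)) = u \<bullet> u" for u
    using symB[of "A *v u" u] by (simp add: CB BA)
qed

section \<open>Averages over fair coin tosses\<close>

text \<open>
  The expectation of \<open>g\<close> at the number of heads among \<open>k\<close> tosses of a fair coin.
\<close>

definition coin_avg :: "nat \<Rightarrow> (nat \<Rightarrow> real) \<Rightarrow> real" where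
  "coin_avg k g = (\<Sum>j\<le>k. real (k choose j) * g j) / 2 ^ k"

lemma coin_avg_0 [simp]: "coin_avg 0 g = g 0"
  by (simp add: coin_avg_def)

lemma coin_avg_Suc: "coin_avg (Suc k) g = (coin_avg k g + coin_avg k (\<lambda>j. g (Suc j))) / 2"
proof -
  have "(\<Sum>j\<le>Suc k. real (Suc k choose j) * g j)
      = g 0 + (\<Sum>j\<le>k. real (k choose Suc j) * g (Suc j)) + (\<Sum>j\<le>k. real (k choose j) * g (Suc j))"
    by (subst sum.atMost_Suc_shift) (simp add: sum.distrib algebra_simps)
  also have "g 0 + (\<Sum>j\<le>k. real (k choose Suc j) * g (Suc j)) = (\<Sum>j\<le>Suc k. real (k choose j) * g j)"
    by (subst sum.atMost_Suc_shift) simp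
  also have "\<dots> = (\<Sum>j\<le>k. real (k choose j) * g j)" by (simp add: binomial_eq_0)
  finally show ?thesis unfolding coin_avg_def by (simp add: field_simps)
qed

lemma coin_avg_add: "coin_avg k (\<lambda>j. g j + h j) = coin_avg k g + coin_avg k h"
  by (simp add: coin_avg_def sum.distrib algebra_simps add_divide_distrib)

lemma coin_avg_cmult: "coin_avg k (\<lambda>j. c * g j) = c * coin_avg k g"
  by (simp add: coin_avg_def sum_distrib_left mult_ac)

lemma coin_avg_diff: "coin_avg k (\<lambda>j. g j - h j) = coin_avg k g - coin_avg k h"
  by (simp add: coin_avg_def sum_subtractf algebra_simps diff_divide_distrib)

lemma coin_avg_mono: "(\<And>j. g j \<le> h j) \<Longrightarrow> coin_avg k g \<le> coin_avg k h"
  by (simp add: coin_avg_def divide_right_mono sum_mono mult_left_mono)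

lemma coin_avg_const: "coin_avg k (\<lambda>_. c) = c"
  by (induction k) (simp_all add: coin_avg_Suc)

text \<open>
  The offset \<open>a\<close> makes the induction work: conditioning on one toss changes \<open>a\<close> into \<open>a + 1\<close> or \<open>a - 1\<close>.
\<close>

lemma coin_avg_second_moment: "coin_avg m (\<lambda>j. (2 * real j - real m + a)\<^sup>2) = real m + a\<^sup>2"
proof (induction m arbitrary: a)
  case (Suc m)
  have "coin_avg (Suc m) (\<lambda>j. (2 * real j - real (Suc m) + a)\<^sup>2)
      = (coin_avg m (\<lambda>j. (2 * real j - real m + (a - 1))\<^sup>2)
         + coin_avg m (\<lambda>j. (2 * real j - real m + (a + 1))\<^sup>2)) / 2"
    by (simp add: coin_avg_Suc algebra_simps)
  then show ?case unfolding Suc.IH by (simp add: power2_eq_square algebra_simps)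
qed simp

text \<open>
  Integration by parts for the fair binomial law: up to a factor, the centred count of heads is the
  logarithmic derivative of its weights. Conditioning on one toss reduces \<open>k + 1\<close> to \<open>k\<close>.
\<close>

lemma coin_avg_by_parts:
  "coin_avg (Suc k) (\<lambda>j. (2 * real j - real (Suc k)) * h j)
   = real (Suc k) / 2 * coin_avg k (\<lambda>j. h (Suc j) - h j)"
proof (induction k arbitrary: h)
  case 0
  show ?case by (simp add: coin_avg_Suc)
next
  case (Suc k)
  let ?w = "\<lambda>j. 2 * real j - real (Suc k)"
  have "coin_avg (Suc (Suc k)) (\<lambda>j. (2 * real j - real (Suc (Suc k))) * h j)
      = (coin_avg (Suc k) (\<lambda>j. ?w j * h j - h j) + coin_avg (Suc k) (\<lambda>j. ?w j * h (Suc j) + h (Suc j))) / 2"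
    by (subst coin_avg_Suc) (simp add: algebra_simps)
  also have "\<dots> = (coin_avg (Suc k) (\<lambda>j. ?w j * h j) + coin_avg (Suc k) (\<lambda>j. ?w j * h (Suc j))
      + coin_avg (Suc k) (\<lambda>j. h (Suc j) - h j)) / 2"
    unfolding coin_avg_diff coin_avg_add by simp
  also have "coin_avg (Suc k) (\<lambda>j. ?w j * h j) + coin_avg (Suc k) (\<lambda>j. ?w j * h (Suc j))
      = real (Suc k) * coin_avg (Suc k) (\<lambda>j. h (Suc j) - h j)"
    unfolding Suc.IH[of h] Suc.IH[of "\<lambda>j. h (Suc j)"] coin_avg_Suc[of k "\<lambda>j. h (Suc j) - h j"]
    by (simp add: field_simps)
  finally show ?case by (simp add: field_simps)
qed

text \<open>
  A shift by one changes the fair binomial law by \<open>O(1 / \<surd>k)\<close> in total variation. Integration by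
  parts turns the difference into an expectation against the centred count of heads, whose first
  absolute moment is at most its standard deviation.
\<close>

lemma abs_coin_avg_difference_le:
  assumes h: "\<And>j. \<bar>h j\<bar> \<le> c"
  shows "\<bar>coin_avg k (\<lambda>j. h (Suc j) - h j)\<bar> \<le> 2 * c / sqrt (real (Suc k))"
proof -
  let ?m = "real (Suc k)"
  let ?w = "\<lambda>j. 2 * real j - ?m"
  have c: "0 \<le> c" using h[of 0] by simp
  \<comment> \<open>the inequality of arithmetic and geometric means, weighted by the standard deviation of \<open>?w\<close>,
    in place of the Cauchy-Schwarz inequality\<close>
  have pt: "\<bar>?w j * h j\<bar> \<le> c * (inverse (2 * sqrt ?m) * (?w j)\<^sup>2 + sqrt ?m / 2)" for j
  proof -
    have "0 \<le> (\<bar>?w j\<bar> - sqrt ?m)\<^sup>2" by simp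
    then have "2 * (\<bar>?w j\<bar> * sqrt ?m) \<le> (?w j)\<^sup>2 + (sqrt ?m)\<^sup>2"
      by (simp add: power2_diff algebra_simps del: real_sqrt_pow2)
    then have "\<bar>?w j\<bar> \<le> inverse (2 * sqrt ?m) * (?w j)\<^sup>2 + sqrt ?m / 2"
      by (simp add: field_simps power2_eq_square del: of_nat_Suc)
    from mult_mono[OF this h[of j]] show ?thesis
      by (simp add: abs_mult mult_ac)
  qed
  have "coin_avg (Suc k) (\<lambda>j. ?w j * h j) \<le> coin_avg (Suc k) (\<lambda>j. c * (inverse (2 * sqrt ?m) * (?w j)\<^sup>2 + sqrt ?m / 2))"
    "coin_avg (Suc k) (\<lambda>j. (-1) * (?w j * h j)) \<le> coin_avg (Suc k) (\<lambda>j. c * (inverse (2 * sqrt ?m) * (?w j)\<^sup>2 + sqrt ?m / 2))"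
    by (intro coin_avg_mono order_trans[OF _ pt]; simp)+
  moreover have "coin_avg (Suc k) (\<lambda>j. c * (inverse (2 * sqrt ?m) * (?w j)\<^sup>2 + sqrt ?m / 2)) = c * sqrt ?m"
  proof -
    have "coin_avg (Suc k) (\<lambda>j. (?w j)\<^sup>2) = sqrt ?m * sqrt ?m"
      using coin_avg_second_moment[of "Suc k" 0] by (simp del: of_nat_Suc)
    then show ?thesis
      unfolding coin_avg_cmult coin_avg_add coin_avg_const by (simp add: field_simps del: of_nat_Suc real_sqrt_mult_self)
  qed
  ultimately have "\<bar>coin_avg (Suc k) (\<lambda>j. ?w j * h j)\<bar> \<le> c * sqrt ?m"
    unfolding coin_avg_cmult[of _ "-1"] by linarith
  then have "?m / 2 * \<bar>coin_avg k (\<lambda>j. h (Suc j) - h j)\<bar> \<le> c * sqrt ?m"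
    unfolding coin_avg_by_parts by (simp add: abs_mult del: of_nat_Suc)
  then have "sqrt ?m * (sqrt ?m * \<bar>coin_avg k (\<lambda>j. h (Suc j) - h j)\<bar>) \<le> sqrt ?m * (2 * c)"
    unfolding mult.assoc[symmetric] by (simp add: mult_ac del: of_nat_Suc)
  then have "sqrt ?m * \<bar>coin_avg k (\<lambda>j. h (Suc j) - h j)\<bar> \<le> 2 * c"
    by (rule mult_left_le_imp_le) simp
  then show ?thesis by (simp add: field_simps del: of_nat_Suc)
qed

text \<open>
  Although convexity makes the average of \<open>1 / \<surd>(x + 1)\<close> and \<open>1 / \<surd>x\<close> exceed the value at the
  average point \<open>x + p\<close>, it is at most the value at \<open>x + p / 2\<close>. This drives the induction on the
  number of summands below, which thereby avoids binomial sums.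
\<close>

lemma inverse_sqrt_convex_step:
  fixes x p :: real
  assumes x: "1 \<le> x" and p: "0 \<le> p" "p \<le> 1"
  shows "p / sqrt (x + 1) + (1 - p) / sqrt x \<le> 1 / sqrt (x + p / 2)"
proof -
  have diff: "1 / sqrt x - 1 / sqrt (x + d) = d / (sqrt x * sqrt (x + d) * (sqrt x + sqrt (x + d)))"
    if "0 \<le> d" for d
  proof -
    have gen: "1 / a - 1 / b = ((b - a) * (a + b)) / (a * b * (a + b))" if "0 < a" "0 < b" for a b :: real
    proof -
      have "a + b \<noteq> 0" using that by linarith
      then have "((b - a) * (a + b)) / (a * b * (a + b)) = (b - a) / (a * b)" by simp
      then show ?thesis using that by (simp add: field_simps)
    qed
    show ?thesis using gen[of "sqrt x" "sqrt (x + d)"] x that by (simp add: algebra_simps)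
  qed
  have p2: "0 \<le> p / 2" using p by simp
  have s: "0 < sqrt x" "sqrt x \<le> sqrt (x + 1)" "sqrt x \<le> sqrt (x + p / 2)" using x p by auto
  have "1 / sqrt x - 1 / sqrt (x + p / 2) \<le> (p / 2) / (sqrt x * sqrt x * (sqrt x + sqrt x))"
    unfolding diff[OF p2] using s p x
    by (intro divide_left_mono mult_mono add_mono mult_pos_pos add_pos_pos) auto
  also have "\<dots> = p / (4 * x * sqrt x)" using x by simp
  also have "\<dots> \<le> p / (sqrt x * ((x + 1) * 2))"
    using s x p by (intro divide_left_mono mult_pos_pos) (auto simp: algebra_simps)
  also have "\<dots> = p * (1 / (sqrt x * sqrt (x + 1) * (sqrt (x + 1) + sqrt (x + 1))))"
    proof -
    have "(x + 1) * 2 = sqrt (x + 1) * (sqrt (x + 1) + sqrt (x + 1))"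
      unfolding distrib_left using x by simp
    then show ?thesis by (simp only: mult.assoc) simp
  qed
  also have "\<dots> \<le> p * (1 / (sqrt x * sqrt (x + 1) * (sqrt x + sqrt (x + 1))))"
    using s p x by (intro mult_left_mono divide_left_mono mult_pos_pos add_pos_pos) auto
  also have "\<dots> = p * (1 / sqrt x - 1 / sqrt (x + 1))"
    using diff[of 1] by simp
  finally show ?thesis by (simp add: algebra_simps diff_divide_distrib)
qed

section \<open>Translation regularity of sums\<close>

text \<open>
  The effect on \<open>f\<close> of a translation by \<open>s\<close>, averaged over \<open>k\<close> previous coin tosses that
  each translate by \<open>0\<close> or \<open>s\<close>.
\<close>

definition coin_diff :: "nat \<Rightarrow> 'v::real_vector \<Rightarrow> ('v \<Rightarrow> real) \<Rightarrow> 'v \<Rightarrow> real" where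
  "coin_diff k s f x = coin_avg k (\<lambda>j. f (x + real (Suc j) *\<^sub>R s) - f (x + real j *\<^sub>R s))"

lemma coin_diff_0: "coin_diff 0 s f x = f (x + s) - f x"
  by (simp add: coin_diff_def)

lemma coin_diff_Suc: "coin_diff (Suc k) s f x = (coin_diff k s f x + coin_diff k s f (x + s)) / 2"
  by (simp add: coin_diff_def coin_avg_Suc scaleR_add_left add_ac)

lemma abs_coin_diff_le:
  assumes "\<And>x. \<bar>f x\<bar> \<le> c"
  shows "\<bar>coin_diff k s f x\<bar> \<le> 2 * c / sqrt (real (Suc k))"
  unfolding coin_diff_def by (rule abs_coin_avg_difference_le) (rule assms)

lemma coin_diff_add: "coin_diff k s (\<lambda>x. f x + g x) x = coin_diff k s f x + coin_diff k s g x"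
  unfolding coin_diff_def by (subst coin_avg_add[symmetric]) (simp add: algebra_simps)

lemma coin_diff_cmult: "coin_diff k s (\<lambda>x. c * f x) x = c * coin_diff k s f x"
  unfolding coin_diff_def by (subst coin_avg_cmult[symmetric]) (simp add: algebra_simps)

lemma coin_diff_shift: "coin_diff k s (\<lambda>x. f (x + h)) x = coin_diff k s f (x + h)"
  by (simp add: coin_diff_def add_ac)

lemma coin_diff_measurable [measurable]:
  fixes f :: "'v::{second_countable_topology, real_normed_vector} \<Rightarrow> real"
  assumes [measurable]: "f \<in> borel_measurable borel"
  shows "coin_diff k s f \<in> borel_measurable borel"
  unfolding coin_diff_def coin_avg_def by measurable

lemma integral_coin_diff:
  fixes f :: "'v::{second_countable_topology, real_normed_vector} \<Rightarrow> real"
  assumes \<mu>: "finite_measure \<mu>" and [measurable_cong]: "sets \<mu> = sets borel"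
    and [measurable]: "f \<in> borel_measurable borel" and f: "\<And>x. \<bar>f x\<bar> \<le> c"
  shows "(\<integral>y. coin_diff k s f (x + y) \<partial>\<mu>) = coin_diff k s (\<lambda>x. \<integral>y. f (x + y) \<partial>\<mu>) x"
proof -
  have int: "integrable \<mu> (\<lambda>y. f (z + y))" for z
    by (rule finite_measure.integrable_const_bound[OF \<mu>, where B=c]) (auto simp: f)
  have "(\<integral>y. coin_diff k s f (x + y) \<partial>\<mu>)
      = (\<integral>y. coin_avg k (\<lambda>j. f ((x + real (Suc j) *\<^sub>R s) + y) - f ((x + real j *\<^sub>R s) + y)) \<partial>\<mu>)"
    by (simp add: coin_diff_def add_ac)
  also have "\<dots> = coin_avg k (\<lambda>j. \<integral>y. f ((x + real (Suc j) *\<^sub>R s) + y) - f ((x + real j *\<^sub>R s) + y) \<partial>\<mu>)"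
    unfolding coin_avg_def by (simp add: int Bochner_Integration.integral_sum)
  also have "\<dots> = coin_diff k s (\<lambda>x. \<integral>y. f (x + y) \<partial>\<mu>) x"
    unfolding coin_diff_def by (simp add: int)
  finally show ?thesis .
qed

text \<open>
  The measure \<open>p (\<nu> + \<nu> shifted by s) / 2\<close> is a part of \<open>\<mu>\<close>. Only integrals of bounded test functions are
  ever compared, so the remaining part needs no name as a measure.
\<close>

definition splits_off :: "('v::real_normed_vector) measure \<Rightarrow> real \<Rightarrow> 'v measure \<Rightarrow> 'v \<Rightarrow> bool" where
  "splits_off \<mu> p \<nu> s \<longleftrightarrow>
     (\<forall>g\<in>borel_measurable borel. (\<forall>x. 0 \<le> g x) \<longrightarrow> bounded (range g) \<longrightarrow>
        p * ((\<integral>y. g y \<partial>\<nu>) + (\<integral>y. g (y + s) \<partial>\<nu>)) / 2 \<le> (\<integral>y. g y \<partial>\<mu>))"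

text \<open>
  For \<open>\<nu>\<close> uniform on a ball \<open>B\<close> concentric with, and of half the radius of, a ball contained in the open set, \<open>B\<close> and its
  translates by vectors no longer than the radius of \<open>B\<close> all stay in the open set, so \<open>p\<close> does not
  depend on \<open>s\<close>.
\<close>

lemma dominates_lebesgue_splits_off:
  fixes \<mu> :: "(real ^ 'n) measure"
  assumes dom: "dominates_lebesgue \<mu>" and prob: "prob_space \<mu>"
    and sets [measurable_cong]: "sets \<mu> = sets borel"
  obtains p \<nu> r where "0 < p" "p \<le> 1" "prob_space \<nu>" "sets \<nu> = sets borel" "0 < r"
    "\<And>s. norm s \<le> r \<Longrightarrow> splits_off \<mu> p \<nu> s"
proof -
  interpret \<mu>: prob_space \<mu> by (rule prob)
  obtain \<epsilon> D where \<epsilon>: "0 < \<epsilon>" and D: "open D" "D \<noteq> {}"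
    and le: "\<And>A. A \<in> sets borel \<Longrightarrow> ennreal \<epsilon> * emeasure lborel (A \<inter> D) \<le> emeasure \<mu> A"
    using dom unfolding dominates_lebesgue_def by blast
  obtain c r' where r': "0 < r'" "ball c r' \<subseteq> D" using D openE by blast
  define r where "r = r' / 2"
  define B where "B = ball c r"
  have r: "0 < r" using r' by (simp add: r_def)
  have [measurable]: "D \<in> sets borel" "B \<in> sets borel" using D by (auto simp: B_def)
  have BD: "y \<in> D" "y + s \<in> D" if "y \<in> B" "norm s \<le> r" for y s
  proof -
    have "dist c (y + s) \<le> dist c y + norm s"
      using dist_triangle[of c "y + s" y] by (simp add: dist_norm)
    then show "y \<in> D" "y + s \<in> D" using that r' r unfolding B_def r_def by (auto intro!: subsetD[OF r'(2)])
  qed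
  define m where "m = measure lborel B"
  have m: "emeasure lborel B = ennreal m" "0 < m"
  proof -
    have "emeasure lborel B \<noteq> top" using emeasure_bounded_finite[of B] by (simp add: B_def)
    then show "emeasure lborel B = ennreal m" by (simp add: m_def emeasure_eq_ennreal_measure)
    show "0 < m" using content_ball_pos[OF r] by (simp add: m_def B_def)
  qed
  define p where "p = \<epsilon> * m"
  define \<nu> where "\<nu> = uniform_measure lborel B"
  have "prob_space \<nu>" unfolding \<nu>_def by (rule prob_space_uniform_measure) (use m in auto)
  then interpret \<nu>: prob_space \<nu> .
  have [measurable_cong, simp]: "sets \<nu> = sets borel" by (simp add: \<nu>_def)
  have main: "splits_off \<mu> p \<nu> s" if s: "norm s \<le> r" for s
    unfolding splits_off_def
  proof (intro ballI impI)
    fix g :: "real ^ 'n \<Rightarrow> real"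
    assume [measurable]: "g \<in> borel_measurable borel" and g0: "\<forall>x. 0 \<le> g x" and "bounded (range g)"
    then obtain K where K: "\<And>x. \<bar>g x\<bar> \<le> K" unfolding bounded_iff by auto
    have shift: "(\<integral>\<^sup>+y. ennreal (g (y + s)) * indicator B y \<partial>lborel)
        = (\<integral>\<^sup>+z. ennreal (g z) * indicator B (z - s) \<partial>lborel)"
      by (subst lborel_distr_plus[symmetric, of s], subst nn_integral_distr) (auto simp: add_ac)
    have "density lborel (\<lambda>x. ennreal \<epsilon> * indicator D x) \<le> \<mu>"
      by (subst le_measure)
        (auto simp: sets emeasure_density mult.assoc indicator_inter_arith[symmetric] nn_integral_cmult
           Int_commute intro!: le)
    from nn_integral_mono_measure[OF _ this, of "\<lambda>x. ennreal (g x)"]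
    have 1: "(\<integral>\<^sup>+x. ennreal \<epsilon> * indicator D x * ennreal (g x) \<partial>lborel) \<le> (\<integral>\<^sup>+x. ennreal (g x) \<partial>\<mu>)"
      by (simp add: sets nn_integral_density)
    have 2: "(\<integral>\<^sup>+x. ennreal (g x) * indicator B x \<partial>lborel) + (\<integral>\<^sup>+y. ennreal (g (y + s)) * indicator B y \<partial>lborel)
        \<le> (\<integral>\<^sup>+x. 2 * (ennreal (g x) * indicator D x) \<partial>lborel)"
      unfolding shift
    proof (subst nn_integral_add[symmetric]; (measurable)?)
      show "(\<integral>\<^sup>+x. ennreal (g x) * indicator B x + ennreal (g x) * indicator B (x - s) \<partial>lborel)
        \<le> (\<integral>\<^sup>+x. 2 * (ennreal (g x) * indicator D x) \<partial>lborel)"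
      proof (rule nn_integral_mono)
        fix x
        have "x \<in> B \<Longrightarrow> x \<in> D" "x - s \<in> B \<Longrightarrow> x \<in> D" using BD[of x s] BD[of "x - s" s] s by auto
        then show "ennreal (g x) * indicator B x + ennreal (g x) * indicator B (x - s)
            \<le> 2 * (ennreal (g x) * indicator D x)"
          by (auto simp: indicator_def mult_2)
      qed
    qed
    have \<nu>: "(\<integral>\<^sup>+y. ennreal (h y) * indicator B y \<partial>lborel) = ennreal (m * (\<integral>y. h y \<partial>\<nu>))"
      if [measurable]: "h \<in> borel_measurable borel" and "\<And>x. 0 \<le> h x" "\<And>x. h x \<le> K" for h :: "real ^ 'n \<Rightarrow> real"
    proof -
      have "integrable \<nu> h"
        by (rule \<nu>.integrable_const_bound[where B=K]) (use that in auto)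
      then have "(\<integral>\<^sup>+y. ennreal (h y) * indicator B y \<partial>lborel) / ennreal m = ennreal (\<integral>y. h y \<partial>\<nu>)"
        unfolding m(1)[symmetric]
        by (subst nn_integral_uniform_measure[symmetric]) (auto simp: \<nu>_def[symmetric] that nn_integral_eq_integral)
      moreover have "X / ennreal m * ennreal m = X" for X
        using m(2) by (simp add: ennreal_divide_times)
      ultimately have "(\<integral>\<^sup>+y. ennreal (h y) * indicator B y \<partial>lborel) = ennreal (\<integral>y. h y \<partial>\<nu>) * ennreal m"
        by metis
      then show ?thesis using that m by (simp add: ennreal_mult'' mult.commute)
    qed
    have int\<mu>: "integrable \<mu> g" by (rule \<mu>.integrable_const_bound[where B=K]) (use K in auto)
    let ?I = "(\<integral>y. g y \<partial>\<nu>) + (\<integral>y. g (y + s) \<partial>\<nu>)"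
    have I0: "0 \<le> (\<integral>y. g y \<partial>\<nu>)" "0 \<le> (\<integral>y. g (y + s) \<partial>\<nu>)" using g0 by auto
    have "ennreal (m * ?I) \<le> 2 * (\<integral>\<^sup>+x. ennreal (g x) * indicator D x \<partial>lborel)"
      using 2 g0 K m I0 abs_le_D1 by (simp add: \<nu> nn_integral_cmult ennreal_plus[symmetric] distrib_left del: ennreal_plus)
    then have "ennreal \<epsilon> * ennreal (m * ?I) \<le> 2 * (ennreal \<epsilon> * (\<integral>\<^sup>+x. ennreal (g x) * indicator D x \<partial>lborel))"
      unfolding mult.left_commute[of 2 "ennreal \<epsilon>"] by (rule mult_left_mono) simp
    also have "\<dots> = 2 * (\<integral>\<^sup>+x. ennreal \<epsilon> * indicator D x * ennreal (g x) \<partial>lborel)"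
      by (subst nn_integral_cmult[symmetric]) (auto simp: mult_ac)
    also have "\<dots> \<le> 2 * ennreal (\<integral>x. g x \<partial>\<mu>)"
      using 1 int\<mu> g0 by (intro mult_left_mono) (auto simp: nn_integral_eq_integral)
    also have "\<dots> = ennreal (2 * (\<integral>x. g x \<partial>\<mu>))"
      using g0 by (simp add: ennreal_mult')
    also have "ennreal \<epsilon> * ennreal (m * ?I) = ennreal (p * ?I)"
      using \<epsilon> m by (simp add: p_def ennreal_mult' mult.assoc)
    finally show "p * ?I / 2 \<le> (\<integral>y. g y \<partial>\<mu>)"
      using g0 by (subst (asm) ennreal_le_iff) auto
  qed
  have "p \<le> 1"
    using main[of 0] r \<mu>.prob_space \<nu>.prob_space unfolding splits_off_def
    by (auto dest!: bspec[of _ _ "\<lambda>_. 1"])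
  then show ?thesis using that[of p \<nu> r] main \<epsilon> m r \<open>prob_space \<nu>\<close> by (auto simp: p_def)
qed

text \<open>
  Conditioning on the last summand: with probability \<open>p\<close> it supplies one more coin toss and replaces
  \<open>f\<close> by the average \<open>L\<close>, otherwise it replaces \<open>f\<close> by \<open>R\<close>, which is bounded by \<open>(1 - p) c\<close>. Thus a
  bound \<open>e n k\<close> for \<open>n\<close> summands after \<open>k\<close> tosses satisfies the recursion
  \<open>e (n + 1) k = p e n (k + 1) + (1 - p) e n k\<close>. Letting \<open>k\<close> vary is what makes the induction close.
\<close>

lemma expectation_coin_diff_le:
  fixes \<mu> :: "('v::{second_countable_topology, real_normed_vector}) measure" and T :: "nat \<Rightarrow> 'a \<Rightarrow> 'v"
  assumes M: "prob_space M" and T: "\<And>n. T n \<in> borel_measurable M"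
    and \<mu>: "prob_space \<mu>" and s\<mu> [measurable_cong]: "sets \<mu> = sets borel"
    and \<nu>: "prob_space \<nu>" and s\<nu> [measurable_cong]: "sets \<nu> = sets borel"
    and p: "0 < p" "p \<le> 1" and split: "splits_off \<mu> p \<nu> s"
    and step: "\<And>n (f :: 'v \<Rightarrow> real) c. f \<in> borel_measurable borel \<Longrightarrow> (\<And>x. \<bar>f x\<bar> \<le> c) \<Longrightarrow>
        (\<integral>\<omega>. f (T (Suc n) \<omega>) \<partial>M) = (\<integral>\<omega>. (\<integral>y. f (T n \<omega> + y) \<partial>\<mu>) \<partial>M)"
    and f: "f \<in> borel_measurable borel" "\<And>x. \<bar>f x\<bar> \<le> c"
  shows "\<bar>\<integral>\<omega>. coin_diff k s f (T n \<omega>) \<partial>M\<bar> \<le> 2 * c / sqrt (1 + real k + p / 2 * real n)"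
  using f
proof (induction n arbitrary: f c k)
  case 0
  interpret prob_space M by (rule M)
  note [measurable] = T 0(1)
  have "\<bar>\<integral>\<omega>. coin_diff k s f (T 0 \<omega>) \<partial>M\<bar> \<le> 2 * c / sqrt (real (Suc k))"
    by (rule order_trans[OF integral_abs_bound], rule integral_le_const[OF integrable_abs])
      (use abs_coin_diff_le[of f c k s, OF 0(2)] in \<open>auto intro!: integrable_const_bound[where B="2 * c / sqrt (real (Suc k))"]\<close>)
  then show ?case by simp
next
  case (Suc n)
  interpret M: prob_space M by (rule M)
  interpret \<mu>: prob_space \<mu> by (rule \<mu>)
  interpret \<nu>: prob_space \<nu> by (rule \<nu>)
  note [measurable] = T Suc.prems(1)
  note fc = Suc.prems(2)
  define L where "L x = (\<integral>y. f (x + y) \<partial>\<nu>)" for x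
  define P where "P x = (\<integral>y. f (x + y) \<partial>\<mu>)" for x
  define R where "R x = P x - p / 2 * (L x + L (x + s))" for x
  have [measurable]: "L \<in> borel_measurable borel" "P \<in> borel_measurable borel"
    unfolding L_def P_def by measurable
  then have [measurable]: "R \<in> borel_measurable borel" unfolding R_def by measurable
  have c: "0 \<le> c" using fc[of undefined] by simp
  have int: "integrable \<mu> (\<lambda>y. f (x + y))" "integrable \<nu> (\<lambda>y. f (x + y))" "integrable \<nu> (\<lambda>y. f (x + (y + s)))" for x
    by (auto intro!: \<mu>.integrable_const_bound[where B=c] \<nu>.integrable_const_bound[where B=c] simp: fc)
  have Lc: "\<bar>L x\<bar> \<le> c" for x unfolding L_def
    by (rule order_trans[OF integral_abs_bound], rule \<nu>.integral_le_const[OF integrable_abs[OF int(2)]]) (simp add: fc)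
  have Ls: "L (x + s) = (\<integral>y. f (x + (y + s)) \<partial>\<nu>)" for x by (simp add: L_def add_ac)
  have Rc: "\<bar>R x\<bar> \<le> (1 - p) * c" for x
  proof -
    \<comment> \<open>the splitting, applied to the nonnegative functions \<open>c + f\<close> and \<open>c - f\<close>\<close>
    have *: "p * ((\<integral>y. c + a * f (x + y) \<partial>\<nu>) + (\<integral>y. c + a * f (x + (y + s)) \<partial>\<nu>)) / 2
        \<le> (\<integral>y. c + a * f (x + y) \<partial>\<mu>)" if a: "a \<in> {1, -1}" for a
    proof -
      have "0 \<le> c + a * f y" "\<bar>c + a * f y\<bar> \<le> 2 * c" for y using fc[of y] a by auto
      then show ?thesis
        by (intro split[unfolded splits_off_def, rule_format]) (auto intro!: boundedI[where B="2 * c"])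
    qed
    have "p * c + a * (p / 2 * (L x + L (x + s))) \<le> c + a * P x" if "a \<in> {1, -1}" for a
    proof -
      have "(\<integral>y. c + a * f (x + y) \<partial>\<nu>) = c + a * L x"
        "(\<integral>y. c + a * f (x + (y + s)) \<partial>\<nu>) = c + a * L (x + s)"
        "(\<integral>y. c + a * f (x + y) \<partial>\<mu>) = c + a * P x"
        unfolding Ls unfolding L_def P_def using int by (simp_all add: \<mu>.prob_space \<nu>.prob_space)
      from *[OF that, unfolded this] show ?thesis by (simp add: algebra_simps)
    qed
    from this[of 1] this[of "-1"] show ?thesis by (simp add: R_def abs_le_iff algebra_simps)
  qed
  have eq: "(\<integral>y. coin_diff k s f (x + y) \<partial>\<mu>) = p * coin_diff (Suc k) s L x + coin_diff k s R x" for x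
  proof -
    have "P = (\<lambda>x. p / 2 * (L x + L (x + s)) + R x)" by (simp add: R_def)
    then have "coin_diff k s P x = p / 2 * (coin_diff k s L x + coin_diff k s L (x + s)) + coin_diff k s R x"
      by (simp only: coin_diff_add coin_diff_cmult coin_diff_shift)
    moreover have "(\<lambda>x. \<integral>y. f (x + y) \<partial>\<mu>) = P" by (simp add: P_def fun_eq_iff)
    ultimately show ?thesis
      unfolding coin_diff_Suc by (simp add: integral_coin_diff[OF \<mu>.finite_measure_axioms s\<mu> Suc.prems])
  qed
  have intT: "integrable M (\<lambda>\<omega>. coin_diff k s g (T n \<omega>))"
    if [measurable]: "g \<in> borel_measurable borel" and "\<And>x. \<bar>g x\<bar> \<le> d" for k g d
    using abs_coin_diff_le[of g d k s, OF that(2)] by (intro M.integrable_const_bound) auto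
  have "(\<integral>\<omega>. coin_diff k s f (T (Suc n) \<omega>) \<partial>M)
      = (\<integral>\<omega>. p * coin_diff (Suc k) s L (T n \<omega>) + coin_diff k s R (T n \<omega>) \<partial>M)"
    unfolding eq[symmetric]
    by (rule step[where c="2 * c / sqrt (real (Suc k))"]) (use abs_coin_diff_le[of f c k s, OF fc] in auto)
  also have "\<dots> = p * (\<integral>\<omega>. coin_diff (Suc k) s L (T n \<omega>) \<partial>M) + (\<integral>\<omega>. coin_diff k s R (T n \<omega>) \<partial>M)"
    by (simp add: intT[OF _ Lc] intT[OF _ Rc])
  also have "\<bar>\<dots>\<bar> \<le> p * (2 * c / sqrt (1 + real (Suc k) + p / 2 * real n))
      + 2 * ((1 - p) * c) / sqrt (1 + real k + p / 2 * real n)"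
  proof (intro order_trans[OF abs_triangle_ineq] add_mono)
    show "\<bar>p * (\<integral>\<omega>. coin_diff (Suc k) s L (T n \<omega>) \<partial>M)\<bar> \<le> p * (2 * c / sqrt (1 + real (Suc k) + p / 2 * real n))"
      unfolding abs_mult using p by (intro mult_mono Suc.IH Lc) auto
    show "\<bar>\<integral>\<omega>. coin_diff k s R (T n \<omega>) \<partial>M\<bar> \<le> 2 * ((1 - p) * c) / sqrt (1 + real k + p / 2 * real n)"
      by (intro Suc.IH Rc) measurable
  qed
  also have "\<dots> = 2 * c * (p / sqrt ((1 + real k + p / 2 * real n) + 1)
      + (1 - p) / sqrt (1 + real k + p / 2 * real n))"
    by (simp add: add_ac algebra_simps)
  also have "\<dots> \<le> 2 * c * (1 / sqrt ((1 + real k + p / 2 * real n) + p / 2))"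
    using p c by (intro mult_left_mono inverse_sqrt_convex_step) auto
  also have "\<dots> = 2 * c / sqrt (1 + real k + p / 2 * real (Suc n))"
    by (simp add: algebra_simps)
  finally show ?case .
qed

text \<open>
  A long translation is performed in steps no longer than \<open>r\<close>, each of which costs \<open>O(1 / \<surd>n)\<close>.
\<close>

lemma expectation_translation_le:
  fixes \<mu> :: "(real ^ 'n) measure" and T :: "nat \<Rightarrow> 'a \<Rightarrow> real ^ 'n"
  assumes M: "prob_space M" and T: "\<And>n. T n \<in> borel_measurable M"
    and \<mu>: "prob_space \<mu>" and s\<mu>: "sets \<mu> = sets borel" and dom: "dominates_lebesgue \<mu>"
    and step: "\<And>n (f :: real ^ 'n \<Rightarrow> real) c. f \<in> borel_measurable borel \<Longrightarrow> (\<And>x. \<bar>f x\<bar> \<le> c) \<Longrightarrow>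
        (\<integral>\<omega>. f (T (Suc n) \<omega>) \<partial>M) = (\<integral>\<omega>. (\<integral>y. f (T n \<omega> + y) \<partial>\<mu>) \<partial>M)"
  obtains K where "0 \<le> K"
    "\<And>n f h. 1 \<le> n \<Longrightarrow> f \<in> borel_measurable borel \<Longrightarrow> (\<And>x. \<bar>f x\<bar> \<le> 1) \<Longrightarrow>
       \<bar>(\<integral>\<omega>. f (T n \<omega> + h) \<partial>M) - (\<integral>\<omega>. f (T n \<omega>) \<partial>M)\<bar> \<le> K * (norm h + 1) / sqrt (real n)"
proof -
  interpret M: prob_space M by (rule M)
  note [measurable] = T
  obtain p \<nu> r where p: "0 < p" "p \<le> 1" and \<nu>: "prob_space \<nu>" "sets \<nu> = sets borel" and r: "0 < r"
    and split: "\<And>s. norm s \<le> r \<Longrightarrow> splits_off \<mu> p \<nu> s"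
    by (rule dominates_lebesgue_splits_off[OF dom \<mu> s\<mu>]) blast
  define a where "a = 2 / sqrt (p / 2)"
  have a: "0 \<le> a" using p by (simp add: a_def)
  have int: "integrable M (\<lambda>\<omega>. f (T n \<omega> + h))"
    if [measurable]: "f \<in> borel_measurable borel" and f: "\<And>x. \<bar>f x\<bar> \<le> 1" for f :: "real^'n \<Rightarrow> real" and n h
    by (rule M.integrable_const_bound[where B=1]) (use f in auto)
  have one: "\<bar>(\<integral>\<omega>. f (T n \<omega> + s) \<partial>M) - (\<integral>\<omega>. f (T n \<omega>) \<partial>M)\<bar> \<le> a / sqrt (real n)"
    if n: "1 \<le> n" and [measurable]: "f \<in> borel_measurable borel" and f: "\<And>x. \<bar>f x\<bar> \<le> 1" and s: "norm s \<le> r" for n f s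
  proof -
    have "\<bar>\<integral>\<omega>. coin_diff 0 s f (T n \<omega>) \<partial>M\<bar> \<le> 2 * 1 / sqrt (1 + real 0 + p / 2 * real n)"
      by (rule expectation_coin_diff_le[OF M T \<mu> s\<mu> \<nu> p split[OF s]]) (fact step that)+
    also have "\<dots> \<le> 2 * 1 / sqrt (p / 2 * real n)"
      using p n by (intro divide_left_mono mult_pos_pos) (auto intro: add_pos_nonneg)
    also have "\<dots> = a / sqrt (real n)" by (simp add: a_def real_sqrt_mult real_sqrt_divide)
    finally show ?thesis
      using int[of f n s] int[of f n 0] f by (simp add: coin_diff_0)
  qed
  have many: "\<bar>(\<integral>\<omega>. f (T n \<omega> + real m *\<^sub>R s) \<partial>M) - (\<integral>\<omega>. f (T n \<omega>) \<partial>M)\<bar> \<le> real m * (a / sqrt (real n))"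
    if n: "1 \<le> n" and [measurable]: "f \<in> borel_measurable borel" and f: "\<And>x. \<bar>f x\<bar> \<le> 1" and s: "norm s \<le> r" for n f s m
  proof (induction m)
    case (Suc m)
    have "\<bar>(\<integral>\<omega>. f ((T n \<omega> + s) + real m *\<^sub>R s) \<partial>M) - (\<integral>\<omega>. f (T n \<omega> + real m *\<^sub>R s) \<partial>M)\<bar> \<le> a / sqrt (real n)"
      by (rule one[of n "\<lambda>x. f (x + real m *\<^sub>R s)"]) (use n f s in auto)
    moreover have "real (Suc m) * (a / sqrt (real n)) = a / sqrt (real n) + real m * (a / sqrt (real n))"
      by (simp add: algebra_simps add_divide_distrib)
    ultimately show ?case using Suc by (simp add: scaleR_add_left add_ac abs_le_iff)
  qed simp
  define K where "K = 2 * a * (1 / r + 1)"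
  have "\<bar>(\<integral>\<omega>. f (T n \<omega> + h) \<partial>M) - (\<integral>\<omega>. f (T n \<omega>) \<partial>M)\<bar> \<le> K * (norm h + 1) / sqrt (real n)"
    if n: "1 \<le> n" and [measurable]: "f \<in> borel_measurable borel" and f: "\<And>x. \<bar>f x\<bar> \<le> 1" for n f h
  proof -
    \<comment> \<open>the number of steps; adding one keeps it positive when \<open>h = 0\<close>\<close>
    define m where "m = nat \<lceil>norm h / r\<rceil> + 1"
    have m: "norm h / r \<le> real m" "real m \<le> norm h / r + 2" "0 < real m"
    proof -
      have "0 \<le> norm h / r" using r by simp
      then show "norm h / r \<le> real m" "real m \<le> norm h / r + 2" "0 < real m"
        unfolding m_def by linarith+
    qed
    have "norm (inverse (real m) *\<^sub>R h) \<le> r" using m r by (simp add: field_simps)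
    from many[of n f "inverse (real m) *\<^sub>R h" m] n f this m
    have "\<bar>(\<integral>\<omega>. f (T n \<omega> + h) \<partial>M) - (\<integral>\<omega>. f (T n \<omega>) \<partial>M)\<bar> \<le> real m * (a / sqrt (real n))" by simp
    also have "\<dots> \<le> (2 * (1 / r + 1) * (norm h + 1)) * (a / sqrt (real n))"
    proof (intro mult_right_mono)
      have "norm h / r + 2 \<le> 2 * (1 / r + 1) * (norm h + 1)" using r by (simp add: field_simps)
      with m show "real m \<le> 2 * (1 / r + 1) * (norm h + 1)" by linarith
    qed (use a in auto)
    also have "\<dots> = K * (norm h + 1) / sqrt (real n)"
      unfolding K_def by (simp only: mult_ac times_divide_eq_right)
    finally show ?thesis .
  qed
  then show ?thesis using that[of K] a r by (simp add: K_def)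
qed

section \<open>Fourier transform of the standard Gaussian\<close>

definition fourier :: "('v::real_inner) measure \<Rightarrow> 'v \<Rightarrow> complex" where
  "fourier \<mu> u = (\<integral>x. iexp (u \<bullet> x) \<partial>\<mu>)"

lemma fourier_0: "prob_space \<mu> \<Longrightarrow> fourier \<mu> 0 = 1"
  by (simp add: fourier_def prob_space.prob_space)

definition gauss_density :: "'v::euclidean_space \<Rightarrow> real" where
  "gauss_density x = (2 * pi) powr (- real DIM('v) / 2) * exp (- (norm x)\<^sup>2 / 2)"

lemma gauss_density_nonneg: "0 \<le> gauss_density x"
  by (simp add: gauss_density_def)

lemma gauss_density_measurable [measurable]: "gauss_density \<in> borel_measurable borel"
  unfolding gauss_density_def by measurable

lemma std_gaussian_eq: "std_gaussian = density lborel (\<lambda>x. ennreal (gauss_density x))"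
  by (simp add: std_gaussian_def gauss_density_def)

text \<open>
  Lebesgue measure on a Euclidean space is a product measure over the standard basis.
\<close>

lemma lborel_integral_prod_Basis:
  fixes g :: "'v::euclidean_space \<Rightarrow> real \<Rightarrow> complex"
  assumes g: "\<And>b. b \<in> Basis \<Longrightarrow> integrable lborel (g b)"
  shows "(\<integral>x. (\<Prod>b\<in>Basis. g b (x \<bullet> b)) \<partial>lborel) = (\<Prod>b\<in>Basis. \<integral>t. g b t \<partial>lborel)"
proof -
  interpret product_sigma_finite "\<lambda>_::'v. lborel :: real measure" ..
  have [measurable]: "g b \<in> borel_measurable borel" if "b \<in> Basis" for b
    using g[OF that] by (simp add: borel_measurable_integrable flip: measurable_lborel1)
  have "(\<integral>x. (\<Prod>b\<in>Basis. g b (x \<bullet> b)) \<partial>lborel)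
     = (\<integral>w. (\<Prod>b\<in>Basis. g b ((\<Sum>c\<in>Basis. w c *\<^sub>R c) \<bullet> b)) \<partial>(\<Pi>\<^sub>M b\<in>(Basis::'v set). lborel))"
    by (subst lborel_eq, subst integral_distr) (simp_all)
  also have "\<dots> = (\<integral>w. (\<Prod>b\<in>Basis. g b (w b)) \<partial>(\<Pi>\<^sub>M b\<in>(Basis::'v set). lborel))"
    by (intro Bochner_Integration.integral_cong prod.cong refl) simp
  also have "\<dots> = (\<Prod>b\<in>Basis. \<integral>t. g b t \<partial>lborel)"
    by (rule product_integral_prod) (simp_all add: g)
  finally show ?thesis .
qed

lemma gauss_density_prod:
  "gauss_density (x :: 'v::euclidean_space) = (\<Prod>b\<in>Basis. std_normal_density (x \<bullet> b))"
proof -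
  have "(norm x)\<^sup>2 = (\<Sum>b\<in>Basis. (x \<bullet> b)\<^sup>2)"
    unfolding power2_norm_eq_inner by (subst euclidean_inner) (simp add: power2_eq_square)
  then have "- (norm x)\<^sup>2 / 2 = (\<Sum>b\<in>Basis. - (x \<bullet> b)\<^sup>2 / 2)"
    by (simp add: sum_negf sum_divide_distrib)
  then have "exp (- (norm x)\<^sup>2 / 2) = (\<Prod>b\<in>Basis. exp (- (x \<bullet> b)\<^sup>2 / 2))"
    by (simp only: exp_sum[OF finite_Basis])
  moreover have "(2 * pi) powr (- real DIM('v) / 2) = (1 / sqrt (2 * pi)) ^ DIM('v)"
  proof -
    have "(2 * pi) powr (- real DIM('v) / 2) = ((2 * pi) powr (- (1 / 2))) powr real DIM('v)"
      by (simp add: powr_powr)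
    also have "\<dots> = ((2 * pi) powr (- (1 / 2))) ^ DIM('v)"
      by (rule powr_realpow) simp
    also have "(2 * pi) powr (- (1 / 2)) = 1 / sqrt (2 * pi)"
      by (simp only: powr_minus_divide powr_half_sqrt[OF less_imp_le[OF pi_gt_zero[THEN mult_pos_pos[OF zero_less_numeral]]]])
    finally show ?thesis .
  qed
  ultimately show ?thesis
    by (simp add: gauss_density_def std_normal_density_def prod.distrib prod_dividef power_divide)
qed

lemma integral_iexp_gauss_density:
  "(\<integral>x. iexp (u \<bullet> x) * complex_of_real (gauss_density x) \<partial>lborel) = exp (- (norm (u::'v::euclidean_space))\<^sup>2 / 2)"
proof -
  let ?g = "\<lambda>(b::'v) t. iexp (u \<bullet> b * t) * complex_of_real (std_normal_density t)"
  have int: "integrable lborel (?g b)" for b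
    by (rule Bochner_Integration.integrable_bound[OF integrable_normal_density[of 1 0]])
      (auto simp: norm_mult)
  have one: "(\<integral>t. ?g b t \<partial>lborel) = exp (- (u \<bullet> b)\<^sup>2 / 2)" for b
  proof -
    have "char std_normal_distribution (u \<bullet> b) = (\<integral>t. ?g b t \<partial>lborel)"
      unfolding char_def by (subst integral_density) (auto simp: scaleR_conv_of_real mult.commute)
    then show ?thesis by (simp add: char_std_normal_distribution)
  qed
  have "iexp (u \<bullet> x) * complex_of_real (gauss_density x) = (\<Prod>b\<in>Basis. ?g b (x \<bullet> b))" for x :: 'v
    by (subst euclidean_inner)
      (simp add: gauss_density_prod sum_distrib_left exp_sum prod.distrib)
  then have "(\<integral>x. iexp (u \<bullet> x) * complex_of_real (gauss_density x) \<partial>lborel) = (\<Prod>b\<in>Basis. \<integral>t. ?g b t \<partial>lborel)"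
    using lborel_integral_prod_Basis[of ?g] int by simp
  also have "\<dots> = (\<Prod>b\<in>Basis. complex_of_real (exp (- (u \<bullet> b)\<^sup>2 / 2)))"
    by (simp only: one)
  also have "\<dots> = exp (- (norm u)\<^sup>2 / 2)"
    unfolding power2_norm_eq_inner euclidean_inner[of u u]
    by (simp add: exp_sum[symmetric] power2_eq_square sum_negf sum_divide_distrib flip: of_real_prod)
  finally show ?thesis .
qed

lemma gauss_density_integral:
  "integrable lborel (gauss_density :: 'v::euclidean_space \<Rightarrow> real)"
  "(\<integral>x. gauss_density (x::'v) \<partial>lborel) = 1"
proof -
  have *: "(\<integral>x. complex_of_real (gauss_density (x::'v)) \<partial>lborel) = 1"
    using integral_iexp_gauss_density[of "0::'v"] by simp
  \<comment> \<open>a nonzero Bochner integral certifies integrability\<close>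
  then have "integrable lborel (\<lambda>x. complex_of_real (gauss_density (x::'v)))"
    using not_integrable_integral_eq by fastforce
  then show 1: "integrable lborel (gauss_density :: 'v \<Rightarrow> real)"
    by (simp add: complex_of_real_integrable_eq)
  show "(\<integral>x. gauss_density (x::'v) \<partial>lborel) = 1" using * by simp
qed

lemma integral_std_gaussian:
  fixes f :: "real ^ 'n \<Rightarrow> 'b::{banach, second_countable_topology}"
  assumes [measurable]: "f \<in> borel_measurable borel"
  shows "(\<integral>x. f x \<partial>std_gaussian) = (\<integral>x. gauss_density x *\<^sub>R f x \<partial>lborel)"
  unfolding std_gaussian_eq by (subst integral_density) (auto simp: gauss_density_nonneg)

lemma sets_std_gaussian [simp, measurable_cong]: "sets std_gaussian = sets borel"
  by (simp add: std_gaussian_eq)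

lemma prob_space_std_gaussian: "prob_space (std_gaussian :: (real ^ 'n) measure)"
proof
  show "emeasure (std_gaussian :: (real ^ 'n) measure) (space std_gaussian) = 1"
    using gauss_density_integral[where 'v="real^'n"]
    by (simp add: std_gaussian_eq emeasure_density nn_integral_eq_integral gauss_density_nonneg)
qed

lemma fourier_std_gaussian: "fourier std_gaussian u = exp (- (norm u)\<^sup>2 / 2)"
proof -
  have "fourier std_gaussian u = (\<integral>x. gauss_density x *\<^sub>R iexp (u \<bullet> x) \<partial>lborel)"
    unfolding fourier_def by (rule integral_std_gaussian) measurable
  also have "\<dots> = (\<integral>x. iexp (u \<bullet> x) * complex_of_real (gauss_density x) \<partial>lborel)"
    by (simp only: scaleR_conv_of_real mult.commute)
  finally show ?thesis by (simp only: integral_iexp_gauss_density)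
qed

section \<open>Densities of smoothed laws\<close>

lemma lborel_integral_scale:
  fixes f :: "'v::euclidean_space \<Rightarrow> 'b::{banach, second_countable_topology}"
  assumes "f \<in> borel_measurable borel" "0 < c"
  shows "(\<integral>x. f x \<partial>lborel) = c ^ DIM('v) *\<^sub>R (\<integral>x. f (c *\<^sub>R x) \<partial>lborel)"
proof -
  have "(\<integral>x. f x \<partial>lborel)
      = (\<integral>x. f x \<partial>density (distr lborel borel (\<lambda>x. 0 + c *\<^sub>R x)) (\<lambda>_. ennreal (\<bar>c\<bar> ^ DIM('v))))"
    by (subst lborel_affine[of c 0]) (use assms(2) in auto)
  also have "\<dots> = (\<integral>x. \<bar>c\<bar> ^ DIM('v) *\<^sub>R f x \<partial>distr lborel borel (\<lambda>x. 0 + c *\<^sub>R x))"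
    by (rule integral_density) (use assms in auto)
  also have "\<dots> = (\<integral>x. \<bar>c\<bar> ^ DIM('v) *\<^sub>R f (0 + c *\<^sub>R x) \<partial>lborel)"
    by (rule integral_distr) (use assms in auto)
  finally show ?thesis using assms(2) by simp
qed

lemma lborel_integral_translate:
  fixes f :: "'v::euclidean_space \<Rightarrow> 'b::{banach, second_countable_topology}"
  assumes "f \<in> borel_measurable borel"
  shows "(\<integral>x. f (x + y) \<partial>lborel) = (\<integral>x. f x \<partial>lborel)"
proof -
  have "(\<integral>x. f x \<partial>lborel) = (\<integral>x. f x \<partial>distr lborel borel ((+) y))"
    by (simp only: lborel_distr_plus)
  also have "\<dots> = (\<integral>x. f (y + x) \<partial>lborel)"
    by (rule integral_distr) (use assms in auto)
  finally show ?thesis by (simp add: add.commute)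
qed

text \<open>
  If \<open>X\<close> has law \<open>\<mu>\<close> and is independent of a vector with density \<open>\<kappa>\<close>, then their sum has density
  \<open>x \<mapsto> E \<kappa>(x - X)\<close>.
\<close>

lemma integral_convolution_density:
  fixes \<mu> :: "('v::euclidean_space) measure" and f :: "'v \<Rightarrow> real"
  assumes \<mu>: "prob_space \<mu>" and s\<mu> [measurable_cong]: "sets \<mu> = sets borel"
    and [measurable]: "\<kappa> \<in> borel_measurable borel" and \<kappa>0: "\<And>x. 0 \<le> \<kappa> x" and \<kappa>i: "integrable lborel \<kappa>"
    and [measurable]: "f \<in> borel_measurable borel" and f: "\<And>x. \<bar>f x\<bar> \<le> c"
  shows "(\<integral>y. (\<integral>x. f (y + x) * \<kappa> x \<partial>lborel) \<partial>\<mu>) = (\<integral>x. f x * (\<integral>y. \<kappa> (x - y) \<partial>\<mu>) \<partial>lborel)"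
    and "integrable lborel (\<lambda>x. \<integral>y. \<kappa> (x - y) \<partial>\<mu>)"
proof -
  interpret \<mu>: prob_space \<mu> by (rule \<mu>)
  interpret pair_sigma_finite \<mu> lborel ..
  have inti: "integrable lborel (\<lambda>x. \<kappa> (x - y))" for y
  proof -
    have "integrable (distr lborel borel ((+) (- y))) \<kappa>" by (simp add: lborel_distr_plus \<kappa>i)
    from integrable_distr[OF _ this] show ?thesis by simp
  qed
  have tr: "(\<integral>x. \<kappa> (x - y) \<partial>lborel) = (\<integral>x. \<kappa> x \<partial>lborel)" for y
    using lborel_integral_translate[of \<kappa> "- y"] by simp
  have int: "integrable (\<mu> \<Otimes>\<^sub>M lborel) (\<lambda>(y, x). \<kappa> (x - y))"
    by (rule Fubini_integrable) (auto simp: inti \<kappa>0 tr)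
  have fint: "integrable (\<mu> \<Otimes>\<^sub>M lborel) (\<lambda>(y, x). f x * \<kappa> (x - y))"
    by (rule Bochner_Integration.integrable_bound[OF integrable_mult_right[of c, OF int]])
      (use f in \<open>auto simp: abs_mult \<kappa>0 intro!: AE_I2 mult_right_mono order_trans[OF f abs_ge_self]\<close>)
  show "integrable lborel (\<lambda>x. \<integral>y. \<kappa> (x - y) \<partial>\<mu>)"
    using integrable_snd[OF int] .
  have "(\<integral>y. (\<integral>x. f (y + x) * \<kappa> x \<partial>lborel) \<partial>\<mu>) = (\<integral>y. (\<integral>x. f x * \<kappa> (x - y) \<partial>lborel) \<partial>\<mu>)"
  proof (rule Bochner_Integration.integral_cong[OF refl])
    fix y
    show "(\<integral>x. f (y + x) * \<kappa> x \<partial>lborel) = (\<integral>x. f x * \<kappa> (x - y) \<partial>lborel)"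
      using lborel_integral_translate[of "\<lambda>x. f x * \<kappa> (x - y)" y] by (simp add: add.commute)
  qed
  also have "\<dots> = (\<integral>x. (\<integral>y. f x * \<kappa> (x - y) \<partial>\<mu>) \<partial>lborel)"
    by (rule Fubini_integral[symmetric, OF fint])
  finally show "(\<integral>y. (\<integral>x. f (y + x) * \<kappa> x \<partial>lborel) \<partial>\<mu>) = (\<integral>x. f x * (\<integral>y. \<kappa> (x - y) \<partial>\<mu>) \<partial>lborel)"
    by simp
qed

text \<open>
  Scheffe's lemma. The bound \<open>a\<close>, the \<open>L\<^sup>1\<close> distance of the densities, is uniform in the test
  function.
\<close>

lemma densities_pointwise_limit_imp_tv:
  fixes q :: "nat \<Rightarrow> 'v::euclidean_space \<Rightarrow> real"
  assumes q: "\<And>n. integrable lborel (q n)" "\<And>n x. 0 \<le> q n x" "\<And>n. (\<integral>x. q n x \<partial>lborel) = 1"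
    and r: "integrable lborel r" "\<And>x. 0 \<le> r x" "(\<integral>x. r x \<partial>lborel) = 1"
    and lim: "\<And>x. (\<lambda>n. q n x) \<longlonglongrightarrow> r x"
  obtains a where "a \<longlonglongrightarrow> 0"
    "\<And>n (f :: 'v \<Rightarrow> real). f \<in> borel_measurable borel \<Longrightarrow> (\<And>x. \<bar>f x\<bar> \<le> 1) \<Longrightarrow>
       \<bar>(\<integral>x. f x * q n x \<partial>lborel) - (\<integral>x. f x * r x \<partial>lborel)\<bar> \<le> a n"
proof -
  define a where "a n = (\<integral>x. \<bar>q n x - r x\<bar> \<partial>lborel)" for n
  have inta: "integrable lborel (\<lambda>x. \<bar>q n x - r x\<bar>)" for n using q(1) r(1) by auto
  have "(\<lambda>n. \<integral>\<^sup>+ x. norm (q n x - r x) \<partial>lborel) \<longlonglongrightarrow> 0"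
    by (rule Scheffe_lemma1) (use q r lim in \<open>auto simp: nn_integral_eq_integral Limsup_const\<close>)
  then have "(\<lambda>n. ennreal (a n)) \<longlonglongrightarrow> ennreal 0"
    using inta by (simp add: nn_integral_eq_integral a_def)
  then have "a \<longlonglongrightarrow> 0"
    by (rule tendsto_ennrealD) (auto simp: a_def)
  moreover have "\<bar>(\<integral>x. f x * q n x \<partial>lborel) - (\<integral>x. f x * r x \<partial>lborel)\<bar> \<le> a n"
    if [measurable]: "f \<in> borel_measurable borel" and f: "\<And>x. \<bar>f x\<bar> \<le> 1" for n and f :: "'v \<Rightarrow> real"
  proof -
    have fi: "integrable lborel (\<lambda>x. f x * g x)" if g: "integrable lborel g" for g
      by (rule Bochner_Integration.integrable_bound[OF g])
        (use f g in \<open>auto simp: abs_mult intro!: mult_left_le_one_le\<close>)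
    have "(\<integral>x. f x * q n x \<partial>lborel) - (\<integral>x. f x * r x \<partial>lborel) = (\<integral>x. f x * (q n x - r x) \<partial>lborel)"
      by (simp add: fi q r algebra_simps)
    also have "\<bar>\<dots>\<bar> \<le> (\<integral>x. \<bar>f x * (q n x - r x)\<bar> \<partial>lborel)" by (rule integral_abs_bound)
    also have "\<dots> \<le> a n" unfolding a_def
    proof (rule integral_mono)
      show "integrable lborel (\<lambda>x. \<bar>f x * (q n x - r x)\<bar>)"
        by (intro integrable_abs fi Bochner_Integration.integrable_diff q r)
      show "integrable lborel (\<lambda>x. \<bar>q n x - r x\<bar>)" by (rule inta)
      show "\<bar>f x * (q n x - r x)\<bar> \<le> \<bar>q n x - r x\<bar>" for x
        using f[of x] by (simp add: abs_mult mult_left_le_one_le)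
    qed
    finally show ?thesis .
  qed
  ultimately show ?thesis using that by blast
qed

text \<open>
  The density of a standard Gaussian vector multiplied by \<open>\<delta>\<close>.
\<close>

definition gauss_kernel :: "real \<Rightarrow> 'v::euclidean_space \<Rightarrow> real" where
  "gauss_kernel \<delta> x = gauss_density ((1 / \<delta>) *\<^sub>R x) / \<delta> ^ DIM('v)"

lemma gauss_kernel_nonneg: "0 \<le> \<delta> \<Longrightarrow> 0 \<le> gauss_kernel \<delta> x"
  by (simp add: gauss_kernel_def gauss_density_nonneg)

lemma gauss_kernel_measurable [measurable]: "gauss_kernel \<delta> \<in> borel_measurable borel"
  unfolding gauss_kernel_def by measurable

lemma gauss_kernel_integral:
  fixes \<delta> :: real assumes \<delta>: "0 < \<delta>"
  shows "integrable lborel (gauss_kernel \<delta> :: 'v::euclidean_space \<Rightarrow> real)"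
    "(\<integral>x. gauss_kernel \<delta> (x::'v) \<partial>lborel) = 1"
proof -
  show *: "(\<integral>x. gauss_kernel \<delta> (x::'v) \<partial>lborel) = 1"
    using \<delta> by (subst lborel_integral_scale[of _ \<delta>]) (auto simp: gauss_kernel_def gauss_density_integral)
  then show "integrable lborel (gauss_kernel \<delta> :: 'v \<Rightarrow> real)"
    using not_integrable_integral_eq by fastforce
qed

lemma integral_std_gaussian_scaled:
  fixes f :: "real ^ 'n \<Rightarrow> real"
  assumes [measurable]: "f \<in> borel_measurable borel" and \<delta>: "0 < \<delta>"
  shows "(\<integral>z. f (\<delta> *\<^sub>R z) \<partial>std_gaussian) = (\<integral>x. f x * gauss_kernel \<delta> x \<partial>lborel)"
proof -
  have "(\<integral>x. f x * gauss_kernel \<delta> x \<partial>lborel)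
      = \<delta> ^ DIM(real^'n) *\<^sub>R (\<integral>x. f (\<delta> *\<^sub>R x) * gauss_kernel \<delta> (\<delta> *\<^sub>R x) \<partial>lborel)"
    by (rule lborel_integral_scale) (use \<delta> in auto)
  also have "\<dots> = (\<integral>x. gauss_density x *\<^sub>R f (\<delta> *\<^sub>R x) \<partial>lborel)"
    using \<delta> by (simp add: gauss_kernel_def mult.commute)
  finally show ?thesis by (subst integral_std_gaussian) auto
qed

text \<open>
  The Gaussian density is its own Fourier transform up to a constant.
\<close>

lemma gauss_density_fourier:
  "complex_of_real (gauss_density w)
   = complex_of_real ((2 * pi) powr (- real CARD('n) / 2)) * (\<integral>z. iexp (w \<bullet> z) \<partial>(std_gaussian :: (real ^ 'n) measure))"
  using fourier_std_gaussian[of w] by (simp add: fourier_def gauss_density_def)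

text \<open>
  Inserting the Fourier representation of the kernel expresses the density of the smoothed law through
  the characteristic function of \<open>\<mu>\<close>, integrated against a probability measure. This takes the
  place of a general Fourier inversion formula, and makes dominated convergence immediate.
\<close>

lemma smoothed_density_fourier:
  fixes \<mu> :: "(real ^ 'n) measure"
  assumes \<mu>: "prob_space \<mu>" and s\<mu> [measurable_cong]: "sets \<mu> = sets borel" and \<delta>: "0 < \<delta>"
  shows "complex_of_real (\<integral>y. gauss_kernel \<delta> (x - y) \<partial>\<mu>)
     = complex_of_real ((2 * pi) powr (- real CARD('n) / 2) / \<delta> ^ CARD('n))
       * (\<integral>z. iexp (x \<bullet> ((1 / \<delta>) *\<^sub>R z)) * fourier \<mu> (- ((1 / \<delta>) *\<^sub>R z)) \<partial>std_gaussian)"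
    (is "_ = ?c * _")
proof -
  interpret \<mu>: prob_space \<mu> by (rule \<mu>)
  interpret G: prob_space "std_gaussian :: (real ^ 'n) measure" by (rule prob_space_std_gaussian)
  interpret pair_prob_space \<mu> "std_gaussian :: (real ^ 'n) measure" ..
  let ?e = "\<lambda>y z. iexp (((1 / \<delta>) *\<^sub>R (x - y)) \<bullet> z)"
  have int: "integrable (\<mu> \<Otimes>\<^sub>M std_gaussian) (\<lambda>(y, z). ?e y z)"
    by (rule P.integrable_const_bound[where B=1]) (auto simp: split_beta)
  have e: "?e y z = iexp (x \<bullet> ((1 / \<delta>) *\<^sub>R z)) * iexp (- ((1 / \<delta>) *\<^sub>R z) \<bullet> y)" for y z
    by (simp add: exp_add[symmetric] inner_diff_left inner_commute algebra_simps diff_divide_distrib)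
  have "complex_of_real (\<integral>y. gauss_kernel \<delta> (x - y) \<partial>\<mu>) = (\<integral>y. complex_of_real (gauss_kernel \<delta> (x - y)) \<partial>\<mu>)"
    by simp
  also have "\<dots> = (\<integral>y. ?c * (\<integral>z. ?e y z \<partial>std_gaussian) \<partial>\<mu>)"
    by (simp add: gauss_kernel_def gauss_density_fourier)
  also have "\<dots> = ?c * (\<integral>y. (\<integral>z. ?e y z \<partial>std_gaussian) \<partial>\<mu>)"
    by simp
  also have "(\<integral>y. (\<integral>z. ?e y z \<partial>std_gaussian) \<partial>\<mu>) = (\<integral>z. (\<integral>y. ?e y z \<partial>\<mu>) \<partial>std_gaussian)"
    by (rule Fubini_integral[symmetric, OF int])
  also have "\<dots> = (\<integral>z. iexp (x \<bullet> ((1 / \<delta>) *\<^sub>R z)) * fourier \<mu> (- ((1 / \<delta>) *\<^sub>R z)) \<partial>std_gaussian)"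
    unfolding e fourier_def by simp
  finally show ?thesis .
qed

lemma fourier_measurable [measurable]:
  fixes \<mu> :: "(real ^ 'n) measure"
  assumes \<mu>: "prob_space \<mu>" and s\<mu> [measurable_cong]: "sets \<mu> = sets borel"
  shows "fourier \<mu> \<in> borel_measurable borel"
proof -
  interpret prob_space \<mu> by (rule \<mu>)
  show ?thesis unfolding fourier_def by measurable
qed

lemma norm_fourier_le:
  assumes \<mu>: "prob_space \<mu>"
  shows "norm (fourier \<mu> u) \<le> 1"
proof -
  interpret prob_space \<mu> by (rule \<mu>)
  have "norm (fourier \<mu> u) \<le> (\<integral>x. norm (iexp (u \<bullet> x)) \<partial>\<mu>)"
    unfolding fourier_def by (rule integral_norm_bound)
  then show ?thesis by (simp add: prob_space)
qed

lemma smoothed_density_tendsto: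
  fixes \<mu> :: "nat \<Rightarrow> (real ^ 'n) measure" and \<nu> :: "(real ^ 'n) measure"
  assumes \<mu>: "\<And>n. prob_space (\<mu> n)" "\<And>n. sets (\<mu> n) = sets borel"
    and \<nu>: "prob_space \<nu>" "sets \<nu> = sets borel" and \<delta>: "0 < \<delta>"
    and lim: "\<And>u. (\<lambda>n. fourier (\<mu> n) u) \<longlonglongrightarrow> fourier \<nu> u"
  shows "(\<lambda>n. \<integral>y. gauss_kernel \<delta> (x - y) \<partial>\<mu> n) \<longlonglongrightarrow> (\<integral>y. gauss_kernel \<delta> (x - y) \<partial>\<nu>)"
proof -
  interpret G: prob_space "std_gaussian :: (real ^ 'n) measure" by (rule prob_space_std_gaussian)
  note [measurable] = fourier_measurable[OF \<mu>] fourier_measurable[OF \<nu>]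
  have "(\<lambda>n. \<integral>z. iexp (x \<bullet> ((1 / \<delta>) *\<^sub>R z)) * fourier (\<mu> n) (- ((1 / \<delta>) *\<^sub>R z)) \<partial>std_gaussian)
    \<longlonglongrightarrow> (\<integral>z. iexp (x \<bullet> ((1 / \<delta>) *\<^sub>R z)) * fourier \<nu> (- ((1 / \<delta>) *\<^sub>R z)) \<partial>std_gaussian)"
  proof (rule integral_dominated_convergence[where w="\<lambda>_. 1"])
    show "AE z in std_gaussian. (\<lambda>n. iexp (x \<bullet> ((1 / \<delta>) *\<^sub>R z)) * fourier (\<mu> n) (- ((1 / \<delta>) *\<^sub>R z)))
        \<longlonglongrightarrow> iexp (x \<bullet> ((1 / \<delta>) *\<^sub>R z)) * fourier \<nu> (- ((1 / \<delta>) *\<^sub>R z))"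
      by (intro AE_I2 tendsto_mult tendsto_const lim)
  qed (auto simp: norm_mult norm_fourier_le[OF \<mu>(1)])
  then have "(\<lambda>n. complex_of_real (\<integral>y. gauss_kernel \<delta> (x - y) \<partial>\<mu> n))
      \<longlonglongrightarrow> complex_of_real (\<integral>y. gauss_kernel \<delta> (x - y) \<partial>\<nu>)"
    unfolding smoothed_density_fourier[OF \<mu> \<delta>] smoothed_density_fourier[OF \<nu> \<delta>]
    by (intro tendsto_mult tendsto_const)
  then show ?thesis by (simp add: tendsto_of_real_iff)
qed

lemma convolution_density_normalised:
  fixes \<mu> :: "('v::euclidean_space) measure" and \<kappa> :: "'v \<Rightarrow> real"
  assumes \<mu>: "prob_space \<mu>" "sets \<mu> = sets borel"
    and \<kappa>: "\<kappa> \<in> borel_measurable borel" "\<And>x. 0 \<le> \<kappa> x" "integrable lborel \<kappa>" "(\<integral>x. \<kappa> x \<partial>lborel) = 1"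
  shows "integrable lborel (\<lambda>x. \<integral>y. \<kappa> (x - y) \<partial>\<mu>)" "(\<integral>x. (\<integral>y. \<kappa> (x - y) \<partial>\<mu>) \<partial>lborel) = 1"
    "0 \<le> (\<integral>y. \<kappa> (x - y) \<partial>\<mu>)"
proof -
  interpret prob_space \<mu> by (rule \<mu>)
  note C = integral_convolution_density[OF \<mu> \<kappa>(1-3), of "\<lambda>_. 1" 1]
  show "integrable lborel (\<lambda>x. \<integral>y. \<kappa> (x - y) \<partial>\<mu>)" using C(2) by simp
  show "(\<integral>x. (\<integral>y. \<kappa> (x - y) \<partial>\<mu>) \<partial>lborel) = 1" using C(1) \<kappa>(4) by (simp add: prob_space)
  show "0 \<le> (\<integral>y. \<kappa> (x - y) \<partial>\<mu>)" by (simp add: \<kappa>(2))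
qed

lemma smoothed_tv_tendsto:
  fixes \<mu> :: "nat \<Rightarrow> (real ^ 'n) measure" and \<nu> :: "(real ^ 'n) measure"
  assumes \<mu>: "\<And>n. prob_space (\<mu> n)" "\<And>n. sets (\<mu> n) = sets borel"
    and \<nu>: "prob_space \<nu>" "sets \<nu> = sets borel" and \<delta>: "0 < \<delta>"
    and lim: "\<And>u. (\<lambda>n. fourier (\<mu> n) u) \<longlonglongrightarrow> fourier \<nu> u"
  obtains a where "a \<longlonglongrightarrow> 0"
    "\<And>n (f :: real ^ 'n \<Rightarrow> real). f \<in> borel_measurable borel \<Longrightarrow> (\<And>x. \<bar>f x\<bar> \<le> 1) \<Longrightarrow>
       \<bar>(\<integral>y. (\<integral>z. f (y + \<delta> *\<^sub>R z) \<partial>std_gaussian) \<partial>\<mu> n)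
         - (\<integral>y. (\<integral>z. f (y + \<delta> *\<^sub>R z) \<partial>std_gaussian) \<partial>\<nu>)\<bar> \<le> a n"
proof -
  note K = gauss_kernel_measurable[of \<delta>] gauss_kernel_nonneg[OF less_imp_le[OF \<delta>]] gauss_kernel_integral[OF \<delta>]
  have eq: "(\<integral>y. (\<integral>z. f (y + \<delta> *\<^sub>R z) \<partial>std_gaussian) \<partial>\<rho>) = (\<integral>x. f x * (\<integral>y. gauss_kernel \<delta> (x - y) \<partial>\<rho>) \<partial>lborel)"
    if \<rho>: "prob_space \<rho>" "sets \<rho> = sets borel" and f [measurable]: "f \<in> borel_measurable borel" "\<And>x. \<bar>f x\<bar> \<le> 1"
    for \<rho> and f :: "real ^ 'n \<Rightarrow> real"
  proof -
    have "(\<integral>z. f (y + \<delta> *\<^sub>R z) \<partial>std_gaussian) = (\<integral>x. f (y + x) * gauss_kernel \<delta> x \<partial>lborel)" for y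
      by (rule integral_std_gaussian_scaled[of "\<lambda>x. f (y + x)"]) (use \<delta> in auto)
    then show ?thesis using integral_convolution_density(1)[OF \<rho> K(1-3) f] by simp
  qed
  note Q = convolution_density_normalised[OF _ _ K]
  obtain a where "a \<longlonglongrightarrow> 0" "\<And>n (f :: real ^ 'n \<Rightarrow> real). f \<in> borel_measurable borel \<Longrightarrow> (\<And>x. \<bar>f x\<bar> \<le> 1) \<Longrightarrow>
       \<bar>(\<integral>x. f x * (\<integral>y. gauss_kernel \<delta> (x - y) \<partial>\<mu> n) \<partial>lborel) - (\<integral>x. f x * (\<integral>y. gauss_kernel \<delta> (x - y) \<partial>\<nu>) \<partial>lborel)\<bar> \<le> a n"
    by (rule densities_pointwise_limit_imp_tv[OF Q(1)[OF \<mu>] Q(3)[OF \<mu>] Q(2)[OF \<mu>] Q(1)[OF \<nu>] Q(3)[OF \<nu>] Q(2)[OF \<nu>]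
        smoothed_density_tendsto[OF \<mu> \<nu> \<delta> lim]]) blast
  then show ?thesis using that[of a] eq[OF \<mu>] eq[OF \<nu>] by simp
qed

text \<open>
  Conditionally on \<open>Z\<close>, the sum \<open>G + \<delta> Z\<close> has the Gaussian density centred at \<open>\<delta> Z\<close>, so
  the density of the sum is an average of translated Gaussian densities, which converges by dominated
  convergence.
\<close>

lemma std_gaussian_smoothing_tv_tendsto:
  assumes \<delta>: "\<And>m. 0 < \<delta> m" "\<delta> \<longlonglongrightarrow> 0"
  obtains b where "b \<longlonglongrightarrow> 0"
    "\<And>m (f :: real ^ 'n \<Rightarrow> real). f \<in> borel_measurable borel \<Longrightarrow> (\<And>x. \<bar>f x\<bar> \<le> 1) \<Longrightarrow>
       \<bar>(\<integral>y. (\<integral>z. f (y + \<delta> m *\<^sub>R z) \<partial>std_gaussian) \<partial>std_gaussian) - (\<integral>y. f y \<partial>std_gaussian)\<bar> \<le> b m"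
proof -
  interpret G: prob_space "std_gaussian :: (real ^ 'n) measure" by (rule prob_space_std_gaussian)
  interpret pair_prob_space "std_gaussian :: (real ^ 'n) measure" "std_gaussian :: (real ^ 'n) measure" ..
  define \<rho> where "\<rho> m = distr std_gaussian borel (\<lambda>z :: real ^ 'n. \<delta> m *\<^sub>R z)" for m
  have \<rho>: "prob_space (\<rho> m)" "sets (\<rho> m) = sets borel" for m
    unfolding \<rho>_def by (auto intro!: G.prob_space_distr)
  note K = gauss_density_measurable gauss_density_nonneg gauss_density_integral[where 'v="real^'n"]
  have int\<rho>: "(\<integral>y. g y \<partial>\<rho> m) = (\<integral>z. g (\<delta> m *\<^sub>R z) \<partial>std_gaussian)" if "g \<in> borel_measurable borel" for g :: "real^'n \<Rightarrow> real" and m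
    unfolding \<rho>_def by (rule integral_distr) (use that in auto)
  have eq: "(\<integral>y. (\<integral>z. f (y + \<delta> m *\<^sub>R z) \<partial>std_gaussian) \<partial>std_gaussian) = (\<integral>x. f x * (\<integral>y. gauss_density (x - y) \<partial>\<rho> m) \<partial>lborel)"
    if f [measurable]: "f \<in> borel_measurable borel" "\<And>x. \<bar>f x\<bar> \<le> 1" for m and f :: "real ^ 'n \<Rightarrow> real"
  proof -
    have int: "integrable (std_gaussian \<Otimes>\<^sub>M std_gaussian) (\<lambda>(y, z). f (y + \<delta> m *\<^sub>R z))"
      by (rule P.integrable_const_bound[where B=1]) (auto simp: split_beta f)
    have "(\<integral>y. (\<integral>z. f (y + \<delta> m *\<^sub>R z) \<partial>std_gaussian) \<partial>std_gaussian) = (\<integral>z. (\<integral>y. f (y + \<delta> m *\<^sub>R z) \<partial>std_gaussian) \<partial>std_gaussian)"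
      by (rule Fubini_integral[symmetric, OF int])
    also have "\<dots> = (\<integral>y. (\<integral>x. f (x + y) \<partial>std_gaussian) \<partial>\<rho> m)"
      by (rule int\<rho>[symmetric]) measurable
    also have "\<dots> = (\<integral>y. (\<integral>x. f (y + x) * gauss_density x \<partial>lborel) \<partial>\<rho> m)"
      by (subst integral_std_gaussian) (auto simp: add.commute mult.commute)
    also have "\<dots> = (\<integral>x. f x * (\<integral>y. gauss_density (x - y) \<partial>\<rho> m) \<partial>lborel)"
      by (rule integral_convolution_density(1)[OF \<rho> K(1-3) f])
    finally show ?thesis .
  qed
  have lim: "(\<lambda>m. \<integral>y. gauss_density (x - y) \<partial>\<rho> m) \<longlonglongrightarrow> gauss_density x" for x :: "real ^ 'n"
  proof -
    have "(\<lambda>m. \<integral>z. gauss_density (x - \<delta> m *\<^sub>R z) \<partial>std_gaussian) \<longlonglongrightarrow> (\<integral>z. gauss_density x \<partial>(std_gaussian :: (real ^ 'n) measure))"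
    proof (rule integral_dominated_convergence[where w="\<lambda>_. (2 * pi) powr (- real DIM(real ^ 'n) / 2)"])
      have "(\<lambda>m. gauss_density (x - \<delta> m *\<^sub>R z)) \<longlonglongrightarrow> gauss_density (x - 0 *\<^sub>R z)" for z
        unfolding gauss_density_def by (intro tendsto_intros \<delta>) auto
      then show "AE z in std_gaussian. (\<lambda>m. gauss_density (x - \<delta> m *\<^sub>R z)) \<longlonglongrightarrow> gauss_density x"
        by simp
    qed (auto simp: gauss_density_def)
    then show ?thesis by (simp add: int\<rho> G.prob_space)
  qed
  note Q = convolution_density_normalised[OF \<rho> K]
  obtain b where "b \<longlonglongrightarrow> 0" "\<And>m (f :: real ^ 'n \<Rightarrow> real). f \<in> borel_measurable borel \<Longrightarrow> (\<And>x. \<bar>f x\<bar> \<le> 1) \<Longrightarrow>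
       \<bar>(\<integral>x. f x * (\<integral>y. gauss_density (x - y) \<partial>\<rho> m) \<partial>lborel) - (\<integral>x. f x * gauss_density x \<partial>lborel)\<bar> \<le> b m"
    by (rule densities_pointwise_limit_imp_tv[OF Q(1) Q(3) Q(2) K(3) K(2) K(4) lim]) blast
  then show ?thesis using that[of b] eq by (simp add: integral_std_gaussian mult.commute)
qed

section \<open>From weak to total variation convergence\<close>

lemma abs_integral_diff_le_2:
  assumes \<mu>: "prob_space \<mu>" and \<nu>: "prob_space \<nu>"
    and f: "\<And>x. \<bar>f x :: real\<bar> \<le> 1"
  shows "\<bar>(\<integral>x. f x \<partial>\<mu>) - (\<integral>x. f x \<partial>\<nu>)\<bar> \<le> 2"
proof -
  have "\<bar>\<integral>x. f x \<partial>\<rho>\<bar> \<le> 1" if "prob_space \<rho>" for \<rho>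
  proof -
    interpret prob_space \<rho> by (rule that)
    show ?thesis
    proof (cases "integrable \<rho> f")
      case True
      have "\<bar>\<integral>x. f x \<partial>\<rho>\<bar> \<le> (\<integral>x. \<bar>f x\<bar> \<partial>\<rho>)" by (rule integral_abs_bound)
      also have "\<dots> \<le> 1" by (rule integral_le_const) (use True f in auto)
      finally show ?thesis .
    qed (simp add: not_integrable_integral_eq)
  qed
  from this[OF \<mu>] this[OF \<nu>] show ?thesis by linarith
qed

text \<open>
  The boundedness of the set of values matters here, since the supremum of an unbounded set of reals
  is unspecified.
\<close>

lemma dTV_nonneg:
  assumes "prob_space \<mu>" "prob_space \<nu>"
  shows "0 \<le> dTV \<mu> \<nu>"
  unfolding dTV_def
proof (rule order_trans[OF _ cSUP_upper])
  show "(\<lambda>_. 0) \<in> {f \<in> borel_measurable borel. \<forall>x. \<bar>f x :: real\<bar> \<le> 1}" by simp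
  show "bdd_above ((\<lambda>f. \<bar>(\<integral>x. f x \<partial>\<mu>) - (\<integral>x. f x \<partial>\<nu>)\<bar>) ` {f \<in> borel_measurable borel. \<forall>x. \<bar>f x :: real\<bar> \<le> 1})"
    by (rule bdd_aboveI2[where M=2]) (use abs_integral_diff_le_2[OF assms] in auto)
qed simp

lemma dTV_le:
  assumes "\<And>f :: 'a::topological_space \<Rightarrow> real. f \<in> borel_measurable borel \<Longrightarrow> (\<And>x. \<bar>f x\<bar> \<le> 1) \<Longrightarrow>
      \<bar>(\<integral>x. f x \<partial>\<mu>) - (\<integral>x. f x \<partial>\<nu>)\<bar> \<le> e"
  shows "dTV \<mu> \<nu> \<le> e"
  unfolding dTV_def by (rule cSUP_least) (use assms in \<open>auto intro: exI[of _ "\<lambda>_. 0"]\<close>)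

text \<open>
  The translation bound is averaged over \<open>h = \<delta> z\<close>. Truncated at \<open>2\<close>, it is bounded
  uniformly in \<open>\<delta>\<close>, so that its average tends to \<open>0\<close> with \<open>\<delta>\<close> by dominated convergence.
\<close>

lemma smoothing_error_le:
  fixes \<mu> :: "(real ^ 'n) measure"
  assumes \<mu>: "prob_space \<mu>" "sets \<mu> = sets borel" and K: "0 \<le> K" "0 \<le> e" and \<delta>: "0 < \<delta>"
    and f: "f \<in> borel_measurable borel" "\<And>x. \<bar>f x :: real\<bar> \<le> 1"
    and shift: "\<And>h. \<bar>(\<integral>y. f (y + h) \<partial>\<mu>) - (\<integral>y. f y \<partial>\<mu>)\<bar> \<le> K * norm h + e"
  shows "\<bar>(\<integral>y. (\<integral>z. f (y + \<delta> *\<^sub>R z) \<partial>std_gaussian) \<partial>\<mu>) - (\<integral>y. f y \<partial>\<mu>)\<bar>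
     \<le> (\<integral>z. min 2 (K * \<delta> * norm z) \<partial>(std_gaussian :: (real ^ 'n) measure)) + e"
proof -
  interpret \<mu>: prob_space \<mu> by (rule \<mu>)
  interpret G: prob_space "std_gaussian :: (real ^ 'n) measure" by (rule prob_space_std_gaussian)
  interpret pair_prob_space \<mu> "std_gaussian :: (real ^ 'n) measure" ..
  note [measurable] = f(1) and [measurable_cong] = \<mu>(2)
  have int: "integrable (\<mu> \<Otimes>\<^sub>M std_gaussian) (\<lambda>(y, z). f (y + \<delta> *\<^sub>R z))"
    by (rule P.integrable_const_bound[where B=1]) (auto simp: split_beta f)
  have int2: "integrable std_gaussian (\<lambda>z. \<integral>y. f (y + \<delta> *\<^sub>R z) \<partial>\<mu>)"
    by (rule integrable_snd[OF int])
  have pt: "\<bar>(\<integral>y. f (y + h) \<partial>\<mu>) - (\<integral>y. f y \<partial>\<mu>)\<bar> \<le> min 2 (K * norm h) + e" for h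
  proof -
    have "prob_space (distr \<mu> borel (\<lambda>y. y + h))" by (rule \<mu>.prob_space_distr) measurable
    from abs_integral_diff_le_2[OF this \<mu>(1), of f, OF f(2)]
    have "\<bar>(\<integral>y. f (y + h) \<partial>\<mu>) - (\<integral>y. f y \<partial>\<mu>)\<bar> \<le> 2" by (simp add: integral_distr)
    with shift[of h] K show ?thesis by linarith
  qed
  have "(\<integral>y. (\<integral>z. f (y + \<delta> *\<^sub>R z) \<partial>std_gaussian) \<partial>\<mu>) - (\<integral>y. f y \<partial>\<mu>)
      = (\<integral>z. (\<integral>y. f (y + \<delta> *\<^sub>R z) \<partial>\<mu>) - (\<integral>y. f y \<partial>\<mu>) \<partial>std_gaussian)"
    using int2 by (simp add: Fubini_integral[OF int] G.prob_space)
  also have "\<bar>\<dots>\<bar> \<le> (\<integral>z. \<bar>(\<integral>y. f (y + \<delta> *\<^sub>R z) \<partial>\<mu>) - (\<integral>y. f y \<partial>\<mu>)\<bar> \<partial>std_gaussian)"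
    by (rule integral_abs_bound)
  also have "\<dots> \<le> (\<integral>z. min 2 (K * \<delta> * norm z) + e \<partial>(std_gaussian :: (real ^ 'n) measure))"
  proof (rule integral_mono)
    show "integrable std_gaussian (\<lambda>z. \<bar>(\<integral>y. f (y + \<delta> *\<^sub>R z) \<partial>\<mu>) - (\<integral>y. f y \<partial>\<mu>)\<bar>)"
      using int2 by simp
    show "integrable (std_gaussian :: (real ^ 'n) measure) (\<lambda>z. min 2 (K * \<delta> * norm z) + e)"
      by (rule G.integrable_const_bound[where B="2 + e"]) (use K \<delta> in auto)
    show "\<bar>(\<integral>y. f (y + \<delta> *\<^sub>R z) \<partial>\<mu>) - (\<integral>y. f y \<partial>\<mu>)\<bar> \<le> min 2 (K * \<delta> * norm z) + e" for z
      using pt[of "\<delta> *\<^sub>R z"] \<delta> by (simp add: mult.assoc)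
  qed
  also have "\<dots> = (\<integral>z. min 2 (K * \<delta> * norm z) \<partial>(std_gaussian :: (real ^ 'n) measure)) + e"
  proof -
    have "integrable (std_gaussian :: (real ^ 'n) measure) (\<lambda>z. min 2 (K * \<delta> * norm z))"
      by (rule G.integrable_const_bound[where B=2]) (use K \<delta> in auto)
    then show ?thesis by (simp add: G.prob_space)
  qed
  finally show ?thesis .
qed

text \<open>
  Smoothing at scale \<open>\<delta>\<close> costs \<open>w\<close> for \<open>\<mu> n\<close> and \<open>b\<close> for the Gaussian law, both small with \<open>\<delta>\<close>; for fixed
  \<open>\<delta>\<close> the two smoothed laws differ by \<open>a n\<close>, which tends to \<open>0\<close>.
\<close>

lemma dTV_std_gaussian_tendsto_0:
  fixes \<mu> :: "nat \<Rightarrow> (real ^ 'n) measure"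
  assumes \<mu>: "\<And>n. prob_space (\<mu> n)" "\<And>n. sets (\<mu> n) = sets borel"
    and lim: "\<And>u. (\<lambda>n. fourier (\<mu> n) u) \<longlonglongrightarrow> fourier std_gaussian u"
    and K: "0 \<le> K"
    and shift: "\<And>n f h. 1 \<le> n \<Longrightarrow> f \<in> borel_measurable borel \<Longrightarrow> (\<And>x. \<bar>f x :: real\<bar> \<le> 1) \<Longrightarrow>
       \<bar>(\<integral>y. f (y + h) \<partial>\<mu> n) - (\<integral>y. f y \<partial>\<mu> n)\<bar> \<le> K * norm h + K / sqrt (real n)"
  shows "(\<lambda>n. dTV (\<mu> n) std_gaussian) \<longlonglongrightarrow> 0"
proof (rule LIMSEQ_I)
  fix e :: real assume e: "0 < e"
  interpret G: prob_space "std_gaussian :: (real ^ 'n) measure" by (rule prob_space_std_gaussian)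
  define \<delta> where "\<delta> m = 1 / real (Suc m)" for m
  have \<delta>: "0 < \<delta> m" for m by (simp add: \<delta>_def)
  have \<delta>0: "\<delta> \<longlonglongrightarrow> 0" unfolding \<delta>_def using LIMSEQ_Suc[OF lim_1_over_n] by simp
  define w where "w m = (\<integral>z. min 2 (K * \<delta> m * norm z) \<partial>(std_gaussian :: (real ^ 'n) measure))" for m
  have "w \<longlonglongrightarrow> (\<integral>z. 0 \<partial>(std_gaussian :: (real ^ 'n) measure))"
    unfolding w_def
  proof (rule integral_dominated_convergence[where w="\<lambda>_. 2"])
    have "(\<lambda>m. min 2 (K * \<delta> m * norm z)) \<longlonglongrightarrow> min 2 (K * 0 * norm z)" for z :: "real ^ 'n"
      by (intro tendsto_intros \<delta>0)
    then show "AE z in (std_gaussian :: (real ^ 'n) measure). (\<lambda>m. min 2 (K * \<delta> m * norm z)) \<longlonglongrightarrow> 0"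
      by simp
    show "AE z in (std_gaussian :: (real ^ 'n) measure). norm (min 2 (K * \<delta> m * norm z)) \<le> 2" for m
      using K less_imp_le[OF \<delta>[of m]] by (intro AE_I2) auto
  qed auto
  then have w: "w \<longlonglongrightarrow> 0" by simp
  obtain b where b: "b \<longlonglongrightarrow> 0" "\<And>m (f :: real ^ 'n \<Rightarrow> real). f \<in> borel_measurable borel \<Longrightarrow> (\<And>x. \<bar>f x\<bar> \<le> 1) \<Longrightarrow>
       \<bar>(\<integral>y. (\<integral>z. f (y + \<delta> m *\<^sub>R z) \<partial>std_gaussian) \<partial>std_gaussian) - (\<integral>y. f y \<partial>std_gaussian)\<bar> \<le> b m"
    by (rule std_gaussian_smoothing_tv_tendsto[OF \<delta> \<delta>0]) blast
  have "(\<lambda>m. w m + b m) \<longlonglongrightarrow> 0 + 0" by (intro tendsto_add w b)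
  from order_tendstoD(2)[OF this, of "e / 2"] e obtain m where m: "w m + b m < e / 2"
    by (auto simp: eventually_sequentially)
  obtain a where a: "a \<longlonglongrightarrow> 0" "\<And>n (f :: real ^ 'n \<Rightarrow> real). f \<in> borel_measurable borel \<Longrightarrow> (\<And>x. \<bar>f x\<bar> \<le> 1) \<Longrightarrow>
       \<bar>(\<integral>y. (\<integral>z. f (y + \<delta> m *\<^sub>R z) \<partial>std_gaussian) \<partial>\<mu> n)
         - (\<integral>y. (\<integral>z. f (y + \<delta> m *\<^sub>R z) \<partial>std_gaussian) \<partial>std_gaussian)\<bar> \<le> a n"
    by (rule smoothed_tv_tendsto[OF \<mu> prob_space_std_gaussian sets_std_gaussian \<delta>[of m] lim]) blast
  have "(\<lambda>n. a n + K / sqrt (real n)) \<longlonglongrightarrow> 0 + 0"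
    by (intro tendsto_add a) (rule real_tendsto_divide_at_top[OF tendsto_const filterlim_compose[OF sqrt_at_top filterlim_real_sequentially]])
  from order_tendstoD(2)[OF this, of "e / 2"] e obtain N where N: "\<And>n. N \<le> n \<Longrightarrow> a n + K / sqrt (real n) < e / 2"
    by (auto simp: eventually_sequentially)
  have "norm (dTV (\<mu> n) std_gaussian - 0) < e" if n: "max N 1 \<le> n" for n
  proof -
    have "dTV (\<mu> n) std_gaussian \<le> (w m + K / sqrt (real n)) + a n + b m"
    proof (rule dTV_le)
      fix f :: "real ^ 'n \<Rightarrow> real" assume f: "f \<in> borel_measurable borel" "\<And>x. \<bar>f x\<bar> \<le> 1"
      have "\<bar>(\<integral>y. (\<integral>z. f (y + \<delta> m *\<^sub>R z) \<partial>std_gaussian) \<partial>\<mu> n) - (\<integral>y. f y \<partial>\<mu> n)\<bar> \<le> w m + K / sqrt (real n)"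
        unfolding w_def by (rule smoothing_error_le[OF \<mu> K _ \<delta> f shift]) (use n f K in auto)
      with a(2)[OF f, of n] b(2)[OF f, of m]
      show "\<bar>(\<integral>y. f y \<partial>\<mu> n) - (\<integral>y. f y \<partial>std_gaussian)\<bar> \<le> (w m + K / sqrt (real n)) + a n + b m"
        by linarith
    qed
    also have "\<dots> < e" using m N[of n] n by linarith
    finally show ?thesis using dTV_nonneg[OF \<mu>(1) prob_space_std_gaussian, of n] by simp
  qed
  then show "\<exists>no. \<forall>n\<ge>no. norm (dTV (\<mu> n) std_gaussian - 0) < e" by blast
qed

section \<open>Moments and laws of the normalised sums\<close>

lemma integrable_inner_product:
  fixes F :: "'a \<Rightarrow> 'v::euclidean_space"
  assumes [measurable]: "F \<in> borel_measurable M" and int: "integrable M (\<lambda>\<omega>. (norm (F \<omega>))\<^sup>2)"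
  shows "integrable M (\<lambda>\<omega>. (x \<bullet> F \<omega>) * (y \<bullet> F \<omega>))"
proof (rule Bochner_Integration.integrable_bound[OF integrable_mult_right[of "norm x * norm y", OF int]])
  have "\<bar>(x \<bullet> F \<omega>) * (y \<bullet> F \<omega>)\<bar> \<le> (norm x * norm (F \<omega>)) * (norm y * norm (F \<omega>))" for \<omega>
    unfolding abs_mult by (intro mult_mono Cauchy_Schwarz_ineq2) auto
  then show "AE \<omega> in M. norm ((x \<bullet> F \<omega>) * (y \<bullet> F \<omega>)) \<le> norm (norm x * norm y * (norm (F \<omega>))\<^sup>2)"
    by (simp add: power2_eq_square mult_ac)
qed measurable

lemma integrable_of_square_integrable:
  fixes F :: "'a \<Rightarrow> 'v::euclidean_space"
  assumes M: "finite_measure M" and [measurable]: "F \<in> borel_measurable M" and int: "integrable M (\<lambda>\<omega>. (norm (F \<omega>))\<^sup>2)"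
  shows "integrable M F"
proof (rule Bochner_Integration.integrable_bound)
  interpret finite_measure M by (rule M)
  show "integrable M (\<lambda>\<omega>. 1 + (norm (F \<omega>))\<^sup>2)" using int by simp
  have "norm (F \<omega>) \<le> 1 + (norm (F \<omega>))\<^sup>2" for \<omega>
    using sum_power2_ge_zero[of "norm (F \<omega>) - 1" 0] by (simp add: power2_diff) (smt (verit) zero_le_power2)
  then show "AE \<omega> in M. norm (F \<omega>) \<le> norm (1 + (norm (F \<omega>))\<^sup>2)" by simp
qed measurable

lemma covariance_matrix_bilinear:
  fixes F :: "'a \<Rightarrow> real ^ 'n"
  assumes M: "finite_measure M" and F [measurable]: "F \<in> borel_measurable M"
    and int: "integrable M (\<lambda>\<omega>. (norm (F \<omega>))\<^sup>2)" and mean: "(\<integral>\<omega>. F \<omega> \<partial>M) = 0"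
  shows "x \<bullet> (covariance_matrix M F *v y) = (\<integral>\<omega>. (x \<bullet> F \<omega>) * (y \<bullet> F \<omega>) \<partial>M)"
proof -
  have "(\<integral>\<omega>. F \<omega> $ i \<partial>M) = 0" for i
  proof -
    have "(\<integral>\<omega>. F \<omega> \<bullet> axis i 1 \<partial>M) = (\<integral>\<omega>. F \<omega> \<partial>M) \<bullet> axis i 1"
      by (rule integral_inner_left) (rule integrable_of_square_integrable[OF M F int])
    then show ?thesis by (simp add: mean inner_axis)
  qed
  then have C: "covariance_matrix M F $ i $ j = (\<integral>\<omega>. F \<omega> $ i * F \<omega> $ j \<partial>M)" for i j
    by (simp add: covariance_matrix_def)
  have intij: "integrable M (\<lambda>\<omega>. F \<omega> $ i * F \<omega> $ j)" for i j
    using integrable_inner_product[OF F int, of "axis i 1" "axis j 1"] by (simp add: inner_axis inner_commute[of "axis _ _"])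
  have "x \<bullet> (covariance_matrix M F *v y) = (\<Sum>i\<in>UNIV. \<Sum>j\<in>UNIV. (x $ i * y $ j) * (\<integral>\<omega>. F \<omega> $ i * F \<omega> $ j \<partial>M))"
    by (simp add: inner_vec_def matrix_vector_mult_def C sum_distrib_left mult_ac)
  also have "\<dots> = (\<integral>\<omega>. (\<Sum>i\<in>UNIV. \<Sum>j\<in>UNIV. (x $ i * y $ j) * (F \<omega> $ i * F \<omega> $ j)) \<partial>M)"
    by (simp add: Bochner_Integration.integral_sum intij)
  also have "\<dots> = (\<integral>\<omega>. (x \<bullet> F \<omega>) * (y \<bullet> F \<omega>) \<partial>M)"
    by (simp add: inner_vec_def sum_product mult_ac)
  finally show ?thesis .
qed

text \<open>
  Hyperplanes are Lebesgue null sets, so \<open>\<mu>\<close> charges the part of the open set outside of any given one.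
  This is what makes the covariance matrix positive definite.
\<close>

lemma dominates_lebesgue_not_in_hyperplane:
  fixes \<mu> :: "(real ^ 'n) measure"
  assumes dom: "dominates_lebesgue \<mu>" and sets: "sets \<mu> = sets borel"
    and AE: "AE x in \<mu>. u \<bullet> x = 0"
  shows "u = 0"
proof (rule ccontr)
  assume u: "u \<noteq> 0"
  obtain \<epsilon> D where \<epsilon>: "0 < \<epsilon>" and D: "open D" "D \<noteq> {}"
    and le: "\<And>A. A \<in> sets borel \<Longrightarrow> ennreal \<epsilon> * emeasure lborel (A \<inter> D) \<le> emeasure \<mu> A"
    using dom unfolding dominates_lebesgue_def by blast
  let ?H = "{x. u \<bullet> x = 0}"
  have H: "?H \<in> sets borel" by measurable
  have "emeasure \<mu> (- ?H) = 0"
    using AE by (subst (asm) AE_iff_measurable[of "- ?H"]) (use H sets sets_eq_imp_space_eq[OF sets] in auto)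
  then have "emeasure lborel (- ?H \<inter> D) = 0"
    using le[of "- ?H"] \<epsilon> H by (auto simp: Compl_in_sets_lebesgue)
  moreover have "?H \<in> null_sets lborel"
    using negligible_hyperplane[of u 0] u H by (simp add: negligible_iff_null_sets null_sets_def)
  ultimately have "D \<in> null_sets lborel"
  proof -
    assume 1: "emeasure lborel (- ?H \<inter> D) = 0" and 2: "?H \<in> null_sets lborel"
    have "- ?H \<inter> D \<in> null_sets lborel" using 1 H D by (auto intro!: null_setsI)
    from null_sets.Un[OF this 2] show ?thesis
      by (rule null_sets_subset) (use D in auto)
  qed
  then have "negligible D" by (simp add: negligible_iff_null_sets null_sets_completionI)
  then show False using open_not_negligible[OF D] by simp
qed

lemma (in prob_space) integral_indep_sum:
  fixes X Y :: "'a \<Rightarrow> 'v::euclidean_space" and f :: "'v \<Rightarrow> real"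
  assumes ind: "indep_var borel X borel Y"
    and f [measurable]: "f \<in> borel_measurable borel" and c: "\<And>x. \<bar>f x\<bar> \<le> c"
  shows "(\<integral>\<omega>. f (X \<omega> + Y \<omega>) \<partial>M) = (\<integral>\<omega>. (\<integral>y. f (X \<omega> + y) \<partial>distr M borel Y) \<partial>M)"
proof -
  have [measurable]: "X \<in> borel_measurable M" "Y \<in> borel_measurable M"
    using indep_var_rv1[OF ind] indep_var_rv2[OF ind] by auto
  interpret X: prob_space "distr M borel X" by (rule prob_space_distr) measurable
  interpret Y: prob_space "distr M borel Y" by (rule prob_space_distr) measurable
  interpret XY: pair_prob_space "distr M borel X" "distr M borel Y" ..
  have int: "integrable (distr M borel X \<Otimes>\<^sub>M distr M borel Y) (\<lambda>(x, y). f (x + y))"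
    by (rule XY.P.integrable_const_bound[where B=c]) (auto simp: split_beta c)
  have "(\<integral>\<omega>. f (X \<omega> + Y \<omega>) \<partial>M) = (\<integral>p. (\<lambda>(x, y). f (x + y)) p \<partial>distr M (borel \<Otimes>\<^sub>M borel) (\<lambda>\<omega>. (X \<omega>, Y \<omega>)))"
    by (subst integral_distr) (auto simp: split_beta)
  also have "\<dots> = (\<integral>p. (\<lambda>(x, y). f (x + y)) p \<partial>(distr M borel X \<Otimes>\<^sub>M distr M borel Y))"
    using ind unfolding indep_var_distribution_eq by simp
  also have "\<dots> = (\<integral>x. (\<integral>y. f (x + y) \<partial>distr M borel Y) \<partial>distr M borel X)"
    by (rule XY.integral_fst'[OF int, symmetric, simplified])
  also have "\<dots> = (\<integral>\<omega>. (\<integral>y. f (X \<omega> + y) \<partial>distr M borel Y) \<partial>M)"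
    by (rule integral_distr) measurable
  finally show ?thesis .
qed

lemma (in prob_space) indep_var_partial_sum:
  fixes Fs :: "nat \<Rightarrow> 'a \<Rightarrow> 'v::euclidean_space"
  assumes ind: "indep_vars (\<lambda>_. borel) Fs {1..}"
  shows "indep_var borel (\<lambda>\<omega>. \<Sum>k = 1..n. Fs k \<omega>) borel (Fs (Suc n))"
proof -
  have "indep_var
    borel ((\<lambda>f. \<Sum>k = 1..n. f k) \<circ> (\<lambda>\<omega>. restrict (\<lambda>i. Fs i \<omega>) {1..n}))
    borel ((\<lambda>f. f (Suc n)) \<circ> (\<lambda>\<omega>. restrict (\<lambda>i. Fs i \<omega>) {Suc n}))"
    by (intro indep_var_compose[OF indep_var_restrict[OF ind]]) auto
  also have "((\<lambda>f. f (Suc n)) \<circ> (\<lambda>\<omega>. restrict (\<lambda>i. Fs i \<omega>) {Suc n})) = Fs (Suc n)"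
    by auto
  also have "((\<lambda>f. \<Sum>k = 1..n. f k) \<circ> (\<lambda>\<omega>. restrict (\<lambda>i. Fs i \<omega>) {1..n})) = (\<lambda>\<omega>. \<Sum>k = 1..n. Fs k \<omega>)"
    by (auto cong: rev_conj_cong)
  finally show ?thesis .
qed

text \<open>
  The one-dimensional central limit theorem normalises by \<open>\<sigma> \<surd>n\<close>; evaluating the characteristic functions
  at \<open>\<sigma>\<close> rather than at \<open>1\<close> undoes the division by \<open>\<sigma>\<close>.
\<close>

lemma (in prob_space) iexp_normalised_sum_tendsto:
  fixes X :: "nat \<Rightarrow> 'a \<Rightarrow> real"
  assumes ind: "indep_vars (\<lambda>_. borel) X {1..}"
    and distr: "\<And>k. 1 \<le> k \<Longrightarrow> distr M borel (X k) = \<mu>"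
    and sq: "integrable \<mu> (\<lambda>x. x\<^sup>2)" and mean: "(\<integral>x. x \<partial>\<mu>) = 0"
    and var: "(\<integral>x. x\<^sup>2 \<partial>\<mu>) = \<sigma>\<^sup>2" and \<sigma>: "0 < \<sigma>"
  shows "(\<lambda>n. \<integral>\<omega>. iexp ((\<Sum>k = 1..n. X k \<omega>) / sqrt (real n)) \<partial>M) \<longlonglongrightarrow> exp (- \<sigma>\<^sup>2 / 2)"
proof -
  define Y where "Y k = X (Suc k)" for k
  have X [measurable]: "X k \<in> borel_measurable M" if "1 \<le> k" for k
    using ind that unfolding indep_vars_def2 by auto
  have Y [measurable]: "Y k \<in> borel_measurable M" for k unfolding Y_def by (rule X) simp
  have dY: "distr M borel (Y k) = \<mu>" for k unfolding Y_def by (rule distr) simp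
  have iY: "indep_vars (\<lambda>_. borel) Y UNIV"
  proof -
    \<comment> \<open>reindexing from \<open>{1..}\<close> to all natural numbers, by way of singleton blocks\<close>
    have "indep_vars (\<lambda>j. PiM {Suc j} (\<lambda>_. borel)) (\<lambda>j \<omega>. restrict (\<lambda>i. X i \<omega>) {Suc j}) UNIV"
      by (rule indep_vars_restrict[OF ind]) (auto simp: disjoint_family_on_def)
    from indep_vars_compose2[OF this, of "\<lambda>j f. f (Suc j)" "\<lambda>_. borel"]
    show ?thesis by (simp add: Y_def[abs_def])
  qed
  have Ym: "expectation (Y k) = 0" for k
    using mean integral_distr[OF Y, of "\<lambda>x. x" k] by (simp add: dY)
  have Yv: "expectation (\<lambda>\<omega>. (Y k \<omega>)\<^sup>2) = \<sigma>\<^sup>2" for k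
    using var integral_distr[OF Y, of "\<lambda>x. x\<^sup>2" k] by (simp add: dY)
  have Yi: "integrable M (\<lambda>\<omega>. (Y k \<omega>)\<^sup>2)" for k
    using sq integrable_distr_eq[OF Y, of "\<lambda>x. x\<^sup>2" k] by (simp add: dY)
  have "weak_conv_m (\<lambda>n. distr M borel (\<lambda>\<omega>. (\<Sum>i<n. Y i \<omega>) / sqrt (n * \<sigma>\<^sup>2))) std_normal_distribution"
    by (rule central_limit_theorem_zero_mean[OF iY Ym \<sigma> Yi _ dY]) (simp add: Ym Yv)
  then have "(\<lambda>n. char (distr M borel (\<lambda>\<omega>. (\<Sum>i<n. Y i \<omega>) / sqrt (n * \<sigma>\<^sup>2))) \<sigma>) \<longlonglongrightarrow> char std_normal_distribution \<sigma>"
    by (intro levy_continuity1) (auto intro!: real_distribution_distr real_dist_normal_dist)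
  moreover have "char (distr M borel (\<lambda>\<omega>. (\<Sum>i<n. Y i \<omega>) / sqrt (n * \<sigma>\<^sup>2))) \<sigma>
      = (\<integral>\<omega>. iexp ((\<Sum>k = 1..n. X k \<omega>) / sqrt (real n)) \<partial>M)" for n
  proof -
    have 1: "\<sigma> * (t / sqrt (n * \<sigma>\<^sup>2)) = t / sqrt (real n)" for t
      using \<sigma> by (simp add: real_sqrt_mult)
    have 2: "(\<Sum>i<n. Y i \<omega>) = (\<Sum>k = 1..n. X k \<omega>)" for \<omega>
      by (simp add: Y_def sum.atLeast1_atMost_eq)
    have "char (distr M borel (\<lambda>\<omega>. (\<Sum>i<n. Y i \<omega>) / sqrt (n * \<sigma>\<^sup>2))) \<sigma>
      = (\<integral>\<omega>. iexp (\<sigma> * ((\<Sum>i<n. Y i \<omega>) / sqrt (n * \<sigma>\<^sup>2))) \<partial>M)"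
      unfolding char_def by (rule integral_distr) measurable
    then show ?thesis unfolding 1 2 .
  qed
  ultimately show ?thesis by (simp add: char_std_normal_distribution)
qed

theorem theorem2p5:
  fixes M0 :: "'b measure" and M :: "'a measure"
    and F :: "'b \<Rightarrow> real ^ 'n" and Fs :: "nat \<Rightarrow> 'a \<Rightarrow> real ^ 'n"
  assumes "prob_space M0"
    and "F \<in> borel_measurable M0"
    and "dominates_lebesgue (distr M0 borel F)"
    and "integrable M0 (\<lambda>\<omega>. (norm (F \<omega>))\<^sup>2)"
    and "(\<integral>\<omega>. F \<omega> \<partial>M0) = 0"
    and "prob_space M"
    and "independent_copies M Fs M0 F"
  shows "(\<lambda>n. dTV
            (distr M borel
               (normalized_sum (matrix_inv (matrix_sqrt (covariance_matrix M0 F))) Fs n))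
            std_gaussian) \<longlonglongrightarrow> 0"
proof -
  interpret M0: prob_space M0 by (rule assms(1))
  interpret M: prob_space M by (rule assms(6))
  note F [measurable] = assms(2) and dom = assms(3) and sq = assms(4) and mean = assms(5)
  define \<mu> where "\<mu> = distr M0 borel F"
  have ind: "M.indep_vars (\<lambda>_. borel) Fs {1..}" and law: "\<And>k. 1 \<le> k \<Longrightarrow> distr M borel (Fs k) = \<mu>"
    using assms(7) by (auto simp: independent_copies_def \<mu>_def)
  have Fs [measurable]: "Fs k \<in> borel_measurable M" if "1 \<le> k" for k
    using ind that unfolding M.indep_vars_def2 by auto
  have \<mu>: "prob_space \<mu>" "sets \<mu> = sets borel"
    unfolding \<mu>_def by (auto intro!: M0.prob_space_distr)
  define C where "C = covariance_matrix M0 F"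
  define B where "B = matrix_sqrt C"
  define A where "A = matrix_inv B"
  note cov = covariance_matrix_bilinear[OF M0.finite_measure_axioms F sq mean, folded C_def]
  have C: "symmetric_psd C"
  proof (rule symmetric_psdI)
    show "x \<bullet> (C *v y) = (C *v x) \<bullet> y" for x y
      unfolding inner_commute[of "C *v x"] cov by (simp add: mult.commute)
    show "0 \<le> x \<bullet> (C *v x)" for x unfolding cov by (simp add: zero_le_square)
  qed
  have pos: "u = 0" if "u \<bullet> (C *v u) = 0" for u
  proof (rule dominates_lebesgue_not_in_hyperplane[OF dom])
    have "(\<integral>\<omega>. (u \<bullet> F \<omega>) * (u \<bullet> F \<omega>) \<partial>M0) = 0" using that unfolding cov .
    then have "AE \<omega> in M0. (u \<bullet> F \<omega>) * (u \<bullet> F \<omega>) = 0"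
      by (subst (asm) integral_nonneg_eq_0_iff_AE) (auto intro!: integrable_inner_product sq)
    then show "AE x in distr M0 borel F. u \<bullet> x = 0"
      by (subst AE_distr_iff) auto
  qed simp
  note W = whitening_matrix[OF C pos, folded B_def, folded A_def]
  define T where "T n \<omega> = (\<Sum>k = 1..n. Fs k \<omega>)" for n \<omega>
  have T [measurable]: "T n \<in> borel_measurable M" for n unfolding T_def by measurable
  define S where "S = normalized_sum A Fs"
  have S: "S n \<omega> = (1 / sqrt (real n)) *\<^sub>R (A *v T n \<omega>)" for n \<omega>
    by (simp add: S_def normalized_sum_def T_def linear_sum[OF matrix_vector_mul_linear])
  have [measurable]: "(*v) A \<in> borel_measurable borel"
    by (intro borel_measurable_continuous_onI linear_continuous_on matrix_vector_mul_bounded_linear)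
  have Sm [measurable]: "S n \<in> borel_measurable M" for n
    unfolding S[abs_def] by measurable
  let ?\<mu> = "\<lambda>n. distr M borel (S n)"
  have step: "(\<integral>\<omega>. f (T (Suc n) \<omega>) \<partial>M) = (\<integral>\<omega>. (\<integral>y. f (T n \<omega> + y) \<partial>\<mu>) \<partial>M)"
    if "f \<in> borel_measurable borel" "\<And>x. \<bar>f x\<bar> \<le> c" for f :: "real ^ 'n \<Rightarrow> real" and n c
    using M.integral_indep_sum[OF M.indep_var_partial_sum[OF ind] that, of n] law[of "Suc n"]
    by (simp add: T_def)
  obtain K where K: "0 \<le> K" "\<And>n f h. 1 \<le> n \<Longrightarrow> f \<in> borel_measurable borel \<Longrightarrow> (\<And>x. \<bar>f x :: real\<bar> \<le> 1) \<Longrightarrow>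
       \<bar>(\<integral>\<omega>. f (T n \<omega> + h) \<partial>M) - (\<integral>\<omega>. f (T n \<omega>) \<partial>M)\<bar> \<le> K * (norm h + 1) / sqrt (real n)"
  proof (rule expectation_translation_le[where T=T, OF M.prob_space_axioms T \<mu> dom[folded \<mu>_def]], goal_cases)
    case (1 n f c)
    show ?case by (rule step) (fact 1)+
  next
    case (2 K)
    show ?case by (rule that) (fact 2)+
  qed
  define b where "b = onorm ((*v) B)"
  have b: "0 \<le> b" "norm (B *v x) \<le> b * norm x" for x
    unfolding b_def by (auto intro!: onorm_pos_le onorm matrix_vector_mul_bounded_linear)
  \<comment> \<open>\<open>A\<close> has inverse \<open>B\<close>, so translating \<open>S n\<close> by \<open>h\<close> translates the plain sum \<open>T n\<close> by \<open>\<surd>n B h\<close>\<close>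
  have shift: "\<bar>(\<integral>y. f (y + h) \<partial>?\<mu> n) - (\<integral>y. f y \<partial>?\<mu> n)\<bar> \<le> (K * (b + 1)) * norm h + (K * (b + 1)) / sqrt (real n)"
    if n: "1 \<le> n" and f [measurable]: "f \<in> borel_measurable borel" "\<And>x. \<bar>f x\<bar> \<le> 1"
    for n h and f :: "real ^ 'n \<Rightarrow> real"
  proof -
    let ?g = "\<lambda>t. f ((1 / sqrt (real n)) *\<^sub>R (A *v t))" and ?h = "sqrt (real n) *\<^sub>R (B *v h)"
    have AB: "A *v (B *v h) = h" by (simp add: matrix_vector_mul_assoc W)
    have "S n \<omega> + h = (1 / sqrt (real n)) *\<^sub>R (A *v (T n \<omega> + ?h))" for \<omega>
      using n by (simp add: S matrix_vector_right_distrib matrix_vector_mult_scaleR AB scaleR_add_right)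
    then have "\<bar>(\<integral>y. f (y + h) \<partial>?\<mu> n) - (\<integral>y. f y \<partial>?\<mu> n)\<bar> = \<bar>(\<integral>\<omega>. ?g (T n \<omega> + ?h) \<partial>M) - (\<integral>\<omega>. ?g (T n \<omega>) \<partial>M)\<bar>"
      by (simp add: integral_distr S)
    also have "\<dots> \<le> K * (norm ?h + 1) / sqrt (real n)"
      by (rule K(2)[OF n]) (use f in auto)
    also have "\<dots> \<le> K * (sqrt (real n) * (b * norm h) + 1) / sqrt (real n)"
      using K(1) b(2)[of h] by (intro divide_right_mono mult_left_mono add_mono) (auto intro: mult_left_mono)
    also have "\<dots> = (K * b) * norm h + K / sqrt (real n)"
      using n by (simp add: field_simps)
    also have "\<dots> \<le> (K * (b + 1)) * norm h + (K * (b + 1)) / sqrt (real n)"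
      using K(1) b(1) by (intro add_mono mult_right_mono divide_right_mono) (auto simp: algebra_simps)
    finally show ?thesis .
  qed
  have fourier: "(\<lambda>n. fourier (?\<mu> n) u) \<longlonglongrightarrow> fourier std_gaussian u" for u
  proof (cases "u = 0")
    case True
    have "prob_space (?\<mu> n)" for n by (rule M.prob_space_distr) measurable
    then show ?thesis
      using True by (simp add: fourier_0 prob_space_std_gaussian)
  next
    case False
    define w where "w = A *v u"
    have eq: "fourier (?\<mu> n) u = (\<integral>\<omega>. iexp ((\<Sum>k = 1..n. w \<bullet> Fs k \<omega>) / sqrt (real n)) \<partial>M)" for n
      unfolding fourier_def by (subst integral_distr) (auto simp: S W(3) w_def T_def inner_sum_right)
    define \<nu> where "\<nu> = distr M0 borel (\<lambda>\<omega>. w \<bullet> F \<omega>)"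
    have "(\<lambda>n. \<integral>\<omega>. iexp ((\<Sum>k = 1..n. w \<bullet> Fs k \<omega>) / sqrt (real n)) \<partial>M) \<longlonglongrightarrow> exp (- (norm u)\<^sup>2 / 2)"
    proof (rule M.iexp_normalised_sum_tendsto[where \<mu>=\<nu>])
      show "M.indep_vars (\<lambda>_. borel) (\<lambda>k \<omega>. w \<bullet> Fs k \<omega>) {1..}"
        by (rule M.indep_vars_compose2[OF ind]) auto
      show "distr M borel (\<lambda>\<omega>. w \<bullet> Fs k \<omega>) = \<nu>" if "1 \<le> k" for k
      proof -
        have "distr M borel (\<lambda>\<omega>. w \<bullet> Fs k \<omega>) = distr (distr M borel (Fs k)) borel (\<lambda>x. w \<bullet> x)"
          using Fs[OF that] by (simp add: distr_distr o_def)
        also have "\<dots> = \<nu>" by (simp add: law[OF that] \<mu>_def \<nu>_def distr_distr o_def)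
        finally show ?thesis .
      qed
      show "integrable \<nu> (\<lambda>x. x\<^sup>2)"
        using integrable_inner_product[OF F sq, of w w] by (simp add: \<nu>_def integrable_distr_eq power2_eq_square)
      have "(\<integral>\<omega>. w \<bullet> F \<omega> \<partial>M0) = w \<bullet> (\<integral>\<omega>. F \<omega> \<partial>M0)"
        by (rule integral_inner_right) (rule integrable_of_square_integrable[OF M0.finite_measure_axioms F sq])
      then show "(\<integral>x. x \<partial>\<nu>) = 0" by (simp add: \<nu>_def integral_distr mean)
      have "(\<integral>\<omega>. (w \<bullet> F \<omega>) * (w \<bullet> F \<omega>) \<partial>M0) = (norm u)\<^sup>2"
        using W(4)[of u] unfolding cov[symmetric] w_def by (simp add: power2_norm_eq_inner)
      then show "(\<integral>x. x\<^sup>2 \<partial>\<nu>) = (norm u)\<^sup>2" by (simp add: \<nu>_def integral_distr power2_eq_square)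
    qed (use False in simp)
    then show ?thesis unfolding eq fourier_std_gaussian by simp
  qed
  have "(\<lambda>n. dTV (?\<mu> n) std_gaussian) \<longlonglongrightarrow> 0"
    by (rule dTV_std_gaussian_tendsto_0[where K="K * (b + 1)"])
      (use K(1) b(1) shift fourier in \<open>auto intro!: M.prob_space_distr\<close>)
  then show ?thesis unfolding S_def A_def B_def C_def .
qed

end
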